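(* Let $M\subset G$ be the Cartan model of the symmetric space $G/K$ defined by $\sigma$, let $X\in\mathbb{K}^{n\times n}$ be nonzero, put $\widehat{X}=X^*+\sigma(X)$, and let $A\in M$ be a critical point of $h_X^M$. Let $\alpha_0\in\Omega_M(A)$. Then the solution of the gradient equation of $h_X^M$, $$4\alpha'=\widehat{X}-\alpha\,\sigma(\widehat{X})\,\alpha,$$ with initial condition $\alpha(0)=\alpha_0$, is the image $\alpha(t)=c_{A^*}(\beta(t))$ by the Cayley transform $c_{A^*}$ of the curve $$\beta(t)=\exp\Bigl(-\tfrac{t}{4}A^*\widehat{X}\Bigr)\,\beta_0\,\exp\Bigl(-\tfrac{t}{4}\widehat{X}A^*\Bigr),$$ where $\beta_0=c_A(\alpha_0)\in T_{A^*}M$.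
   Context: Let $\mathbb{K}$ be one of $\mathbb{R}$, $\mathbb{C}$, $\mathbb{H}$ (quaternions). For a matrix $A\in\mathbb{K}^{n\times n}$, $A^*$ denotes its conjugate transpose. $G$ is the identity component of the compact Lie group $O(n,\mathbb{K})=\{A\in\mathbb{K}^{n\times n}: AA^*=I\}$, i.e. $G=SO(n)$, $U(n)$ or $Sp(n)$. $\mathbb{K}^{n\times n}$ carries the real inner product $\langle Y,Z\rangle=\Re\operatorname{Tr}(Y^*Z)$ (real part of the trace), and submanifolds carry the induced metric. $\sigma\colon G\to G$ is an involutive automorphism which is the restriction of an involutive automorphism $\sigma\colon\mathbb{K}^{n\times n}\to\mathbb{K}^{n\times n}$ of unital (real) algebras satisfying $\sigma(Y^* )=\sigma(Y)^*$ for all $Y\in\mathbb{K}^{n\times n}$. $K=\{B\in G:\sigma(B)=B\}$ is the fixed point subgroup. The Cartan model of $G/K$ is the submanifold $M=\{B\sigma(B)^{-1}: B\in G\}\subset G$, i.e. the image of $G/K\to G$, $[B]\mapsto B\sigma(B)^{-1}$; it is the connected component of the identity of $N=\{B\in G:\sigma(B)=B^{-1}\}$. For $A\in M$ the tangent space, viewed inside $\mathbb{K}^{n\times n}$, is $T_AM=\{Y\in\mathbb{K}^{n\times n}: YA^*+AY^*=0,\ \sigma(Y)=Y^*\}$. For $X\in\mathbb{K}^{n\times n}$, $h_X(Y)=\Re\operatorname{Tr}(XY)$ and $h_X^M$ is its restriction to $M$. For $A\in G$, $\Omega(A)=\{Y\in\mathbb{K}^{n\times n}: A+Y\text{ is invertible}\}$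 and the Cayley transform centered at $A$ is the diffeomorphism $c_A\colon\Omega(A)\to\Omega(A^* )$, $c_A(Y)=(I-A^*Y)(A+Y)^{-1}$, with inverse $c_{A^*}$. For $A\in M$, $\Omega_M(A)=\Omega(A)\cap M$. *)

theory Defs
  imports "HOL-Analysis.Analysis"
begin

section \<open>Quaternions\<close>

codatatype quat = Quat (Q0: real) (Q1: real) (Q2: real) (Q3: real)

lemma quat_eq_iff: "x = y \<longleftrightarrow> Q0 x = Q0 y \<and> Q1 x = Q1 y \<and> Q2 x = Q2 y \<and> Q3 x = Q3 y"
  by (auto intro: quat.expand)

instantiation quat :: ring_1
begin

primcorec zero_quat where
  "Q0 0 = 0" | "Q1 0 = 0" | "Q2 0 = 0" | "Q3 0 = 0"

primcorec one_quat where
  "Q0 1 = 1" | "Q1 1 = 0" | "Q2 1 = 0" | "Q3 1 = 0"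

primcorec plus_quat where
  "Q0 (x + y) = Q0 x + Q0 y"
| "Q1 (x + y) = Q1 x + Q1 y"
| "Q2 (x + y) = Q2 x + Q2 y"
| "Q3 (x + y) = Q3 x + Q3 y"

primcorec uminus_quat where
  "Q0 (- x) = - Q0 x" | "Q1 (- x) = - Q1 x" | "Q2 (- x) = - Q2 x" | "Q3 (- x) = - Q3 x"

primcorec minus_quat where
  "Q0 (x - y) = Q0 x - Q0 y"
| "Q1 (x - y) = Q1 x - Q1 y"
| "Q2 (x - y) = Q2 x - Q2 y"
| "Q3 (x - y) = Q3 x - Q3 y"

primcorec times_quat where
  "Q0 (x * y) = Q0 x * Q0 y - Q1 x * Q1 y - Q2 x * Q2 y - Q3 x * Q3 y"
| "Q1 (x * y) = Q0 x * Q1 y + Q1 x * Q0 y + Q2 x * Q3 y - Q3 x * Q2 y"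
| "Q2 (x * y) = Q0 x * Q2 y - Q1 x * Q3 y + Q2 x * Q0 y + Q3 x * Q1 y"
| "Q3 (x * y) = Q0 x * Q3 y + Q1 x * Q2 y - Q2 x * Q1 y + Q3 x * Q0 y"

instance
  by standard (simp_all add: quat_eq_iff algebra_simps)

end

instantiation quat :: real_algebra_1
begin

primcorec scaleR_quat where
  "Q0 (r *\<^sub>R x) = r * Q0 x"
| "Q1 (r *\<^sub>R x) = r * Q1 x"
| "Q2 (r *\<^sub>R x) = r * Q2 x"
| "Q3 (r *\<^sub>R x) = r * Q3 x"

instance
  by standard (simp_all add: quat_eq_iff algebra_simps)

end

definition quat_cnj :: "quat \<Rightarrow> quat" where
  "quat_cnj x = Quat (Q0 x) (- Q1 x) (- Q2 x) (- Q3 x)"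

instantiation quat :: real_inner
begin

definition inner_quat :: "quat \<Rightarrow> quat \<Rightarrow> real" where
  "inner x y = Q0 x * Q0 y + Q1 x * Q1 y + Q2 x * Q2 y + Q3 x * Q3 y"

definition norm_quat :: "quat \<Rightarrow> real" where
  "norm x = sqrt (inner x x)" for x :: quat

definition sgn_quat :: "quat \<Rightarrow> quat" where
  "sgn x = x /\<^sub>R norm x" for x :: quat

definition dist_quat :: "quat \<Rightarrow> quat \<Rightarrow> real" where
  "dist x y = norm (x - y)" for x y :: quat

definition uniformity_quat :: "(quat \<times> quat) filter" where
  "uniformity_quat = (INF e\<in>{0 <..}. principal {(x, y). dist x y < e})"

definition open_quat :: "quat set \<Rightarrow> bool" where
  "open_quat U \<longleftrightarrow> (\<forall>x\<in>U. eventually (\<lambda>(x', y). x' = x \<longrightarrow> y \<in> U) uniformity)"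

instance
proof
  fix x y z :: quat and r :: real and U :: "quat set"
  show "dist x y = norm (x - y)" by (rule dist_quat_def)
  show "sgn x = x /\<^sub>R norm x" by (rule sgn_quat_def)
  show "(uniformity :: (quat \<times> quat) filter) = (INF e\<in>{0 <..}. principal {(x, y). dist x y < e})"
    by (rule uniformity_quat_def)
  show "open U \<longleftrightarrow> (\<forall>x\<in>U. eventually (\<lambda>(x', y). x' = x \<longrightarrow> y \<in> U) uniformity)"
    by (rule open_quat_def)
  show "inner x y = inner y x" by (simp add: inner_quat_def mult.commute)
  show "inner (x + y) z = inner x z + inner y z"
    by (simp add: inner_quat_def algebra_simps)
  show "inner (r *\<^sub>R x) y = r * inner x y"
    by (simp add: inner_quat_def algebra_simps)
  show "0 \<le> inner x x" by (simp add: inner_quat_def)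
  show "inner x x = 0 \<longleftrightarrow> x = 0"
    by (simp add: inner_quat_def quat_eq_iff add_nonneg_eq_0_iff)
  show "norm x = sqrt (inner x x)" by (rule norm_quat_def)
qed

end

instantiation quat :: real_normed_div_algebra
begin

definition inverse_quat :: "quat \<Rightarrow> quat" where
  "inverse x = quat_cnj x /\<^sub>R inner x x"

definition divide_quat :: "quat \<Rightarrow> quat \<Rightarrow> quat" where
  "x div y = x * inverse y" for x y :: quat

instance
proof
  fix x y :: quat
  have cnj: "x * quat_cnj x = inner x x *\<^sub>R 1" "quat_cnj x * x = inner x x *\<^sub>R 1"
    by (simp_all add: quat_eq_iff quat_cnj_def inner_quat_def)
  show "x \<noteq> 0 \<Longrightarrow> inverse x * x = 1" by (simp add: inverse_quat_def cnj)
  show "x \<noteq> 0 \<Longrightarrow> x * inverse x = 1" by (simp add: inverse_quat_def cnj)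
  show "x div y = x * inverse y" by (rule divide_quat_def)
  show "inverse (0::quat) = 0" by (simp add: inverse_quat_def inner_quat_def)
  have "inner (x * y) (x * y) = inner x x * inner y y"
    by (simp add: inner_quat_def algebra_simps)
  then show "norm (x * y) = norm x * norm y"
    by (simp add: norm_quat_def real_sqrt_mult)
qed

end

instantiation quat :: euclidean_space
begin

definition Basis_quat :: "quat set" where
  "Basis = {Quat 1 0 0 0, Quat 0 1 0 0, Quat 0 0 1 0, Quat 0 0 0 1}"

instance
proof
  show "(Basis :: quat set) \<noteq> {}" "finite (Basis :: quat set)"
    by (simp_all add: Basis_quat_def)
  fix u v x :: quat
  show "u \<in> Basis \<Longrightarrow> v \<in> Basis \<Longrightarrow> inner u v = (if u = v then 1 else 0)"
    by (simp add: Basis_quat_def) (elim disjE; simp add: inner_quat_def)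
  show "(\<forall>u\<in>Basis. inner x u = 0) \<longleftrightarrow> x = 0"
    unfolding Basis_quat_def ball_simps by (simp add: inner_quat_def quat_eq_iff[of x 0])
qed

end

section \<open>The ground algebra\<close>

text \<open>
  The three instances of this class established below are the reals, the complex numbers and the
  quaternions with their usual conjugation, real part and norm. By Frobenius' theorem every
  instance is isomorphic to one of these; moreover the last two axioms determine the conjugation
  and the real part.
\<close>

class rch_algebra = real_normed_div_algebra + euclidean_space +
  fixes kcnj :: "'a \<Rightarrow> 'a"
    and kRe :: "'a \<Rightarrow> real"
  assumes kcnj_kcnj: "kcnj (kcnj x) = x"
    and kcnj_add: "kcnj (x + y) = kcnj x + kcnj y"
    and kcnj_scaleR: "kcnj (r *\<^sub>R x) = r *\<^sub>R kcnj x"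
    and kcnj_mult: "kcnj (x * y) = kcnj y * kcnj x"
    and add_kcnj: "x + kcnj x = (2 * kRe x) *\<^sub>R 1"
    and mult_kcnj: "x * kcnj x = (norm x)\<^sup>2 *\<^sub>R 1"

instantiation real :: rch_algebra
begin

definition kcnj_real :: "real \<Rightarrow> real" where "kcnj_real x = x"

definition kRe_real :: "real \<Rightarrow> real" where "kRe_real x = x"

instance
  by standard (simp_all add: kcnj_real_def kRe_real_def power2_eq_square)

end

instantiation complex :: rch_algebra
begin

definition kcnj_complex :: "complex \<Rightarrow> complex" where "kcnj_complex = cnj"

definition kRe_complex :: "complex \<Rightarrow> real" where "kRe_complex = Re"

instance
proof
  fix x :: complex
  show "x * kcnj x = (norm x)\<^sup>2 *\<^sub>R 1"
    by (metis complex_norm_square kcnj_complex_def scaleR_conv_of_real mult.right_neutral)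
qed (simp_all add: kcnj_complex_def kRe_complex_def complex_eq_iff)

end

instantiation quat :: rch_algebra
begin

definition kcnj_quat :: "quat \<Rightarrow> quat" where "kcnj_quat = quat_cnj"

definition kRe_quat :: "quat \<Rightarrow> real" where "kRe_quat = Q0"

instance
  by standard (simp_all add: kcnj_quat_def kRe_quat_def quat_cnj_def quat_eq_iff
      power2_norm_eq_inner inner_quat_def algebra_simps)

end

section \<open>Matrices\<close>

text \<open>
  Products, units and inverses of matrices are always \<open>(**)\<close>, \<open>mat 1\<close> and \<open>matrix_inv\<close>;
  the instance of \<open>(*)\<close> on \<open>vec\<close> is the componentwise product.
\<close>

definition adj :: "'k::rch_algebra^'n^'m \<Rightarrow> 'k^'m^'n" where
  "adj A = (\<chi> i j. kcnj (A $ j $ i))"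

definition re_tr :: "'k::rch_algebra^'n^'n \<Rightarrow> real" where
  "re_tr A = kRe (trace A)"

definition mat_pow :: "'k::rch_algebra^'n^'n \<Rightarrow> nat \<Rightarrow> 'k^'n^'n" where
  "mat_pow A m = (((**) A) ^^ m) (mat 1)"

definition mat_exp :: "'k::rch_algebra^'n^'n \<Rightarrow> 'k^'n^'n" where
  "mat_exp A = (\<Sum>m. mat_pow A m /\<^sub>R fact m)"

definition orth_grp :: "('k::rch_algebra^'n^'n) set" where
  "orth_grp = {A. A ** adj A = mat 1}"

definition G_grp :: "('k::rch_algebra^'n^'n) set" where
  "G_grp = connected_component_set orth_grp (mat 1)"

section \<open>The Cartan model\<close>

text \<open>
  An involutive automorphism of the unital real algebra of matrices that commutes with the
  conjugate transpose and restricts to a map of \<open>G_grp\<close>. Involutive means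
  \<open>\<sigma> \<circ> \<sigma> = id\<close>; the identity is allowed.
\<close>

definition cartan_involution :: "('k::rch_algebra^'n^'n \<Rightarrow> 'k^'n^'n) \<Rightarrow> bool" where
  "cartan_involution \<sigma> \<longleftrightarrow>
     linear \<sigma> \<and> \<sigma> (mat 1) = mat 1 \<and> (\<forall>Y Z. \<sigma> (Y ** Z) = \<sigma> Y ** \<sigma> Z) \<and>
     (\<forall>Y. \<sigma> (\<sigma> Y) = Y) \<and> (\<forall>Y. \<sigma> (adj Y) = adj (\<sigma> Y)) \<and> \<sigma> ` G_grp = G_grp"

definition cartan_model :: "('k::rch_algebra^'n^'n \<Rightarrow> 'k^'n^'n) \<Rightarrow> ('k^'n^'n) set" where
  "cartan_model \<sigma> = {B ** matrix_inv (\<sigma> B) | B. B \<in> G_grp}"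

definition cartan_tangent ::
    "('k::rch_algebra^'n^'n \<Rightarrow> 'k^'n^'n) \<Rightarrow> 'k^'n^'n \<Rightarrow> ('k^'n^'n) set" where
  "cartan_tangent \<sigma> A = {Y. Y ** adj A + A ** adj Y = 0 \<and> \<sigma> Y = adj Y}"

definition height :: "'k::rch_algebra^'n^'n \<Rightarrow> 'k^'n^'n \<Rightarrow> real" where
  "height X Y = re_tr (X ** Y)"

text \<open>
  Critical points and the gradient of the restriction to \<open>cartan_model \<sigma>\<close> of a function \<open>f\<close>
  defined on the whole matrix space: the differential of the restriction at \<open>A\<close> is the
  restriction to the tangent space of the differential of \<open>f\<close>.
\<close>

definition cartan_critical ::
    "('k::rch_algebra^'n^'n \<Rightarrow> 'k^'n^'n) \<Rightarrow> ('k^'n^'n \<Rightarrow> real) \<Rightarrow> 'k^'n^'n \<Rightarrow> bool" where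
  "cartan_critical \<sigma> f A \<longleftrightarrow> A \<in> cartan_model \<sigma> \<and>
     (\<exists>D. (f has_derivative D) (at A) \<and> (\<forall>Y\<in>cartan_tangent \<sigma> A. D Y = 0))"

definition cartan_gradient ::
    "('k::rch_algebra^'n^'n \<Rightarrow> 'k^'n^'n) \<Rightarrow> ('k^'n^'n \<Rightarrow> real) \<Rightarrow> 'k^'n^'n \<Rightarrow> 'k^'n^'n \<Rightarrow> bool"
  where
  "cartan_gradient \<sigma> f A V \<longleftrightarrow> V \<in> cartan_tangent \<sigma> A \<and>
     (\<exists>D. (f has_derivative D) (at A) \<and>
          (\<forall>Y\<in>cartan_tangent \<sigma> A. D Y = re_tr (adj V ** Y)))"

section \<open>The Cayley transform\<close>

definition cayley_dom :: "'k::rch_algebra^'n^'n \<Rightarrow> ('k^'n^'n) set" where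
  "cayley_dom A = {Y. invertible (A + Y)}"

text \<open>Only meaningful on \<open>cayley_dom A\<close>.\<close>

definition cayley :: "'k::rch_algebra^'n^'n \<Rightarrow> 'k^'n^'n \<Rightarrow> 'k^'n^'n" where
  "cayley A Y = (mat 1 - adj A ** Y) ** matrix_inv (A + Y)"

section \<open>The gradient equation\<close>

definition solves_gradient_eq ::
    "('k::rch_algebra^'n^'n \<Rightarrow> 'k^'n^'n) \<Rightarrow> 'k^'n^'n \<Rightarrow> real set \<Rightarrow> (real \<Rightarrow> 'k^'n^'n) \<Rightarrow> bool"
  where
  "solves_gradient_eq \<sigma> Xh J \<alpha> \<longleftrightarrow>
     (\<forall>t\<in>J. \<exists>\<alpha>'. (\<alpha> has_vector_derivative \<alpha>') (at t within J) \<and>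
              4 *\<^sub>R \<alpha>' = Xh - \<alpha> t ** \<sigma> Xh ** \<alpha> t)"

end

theory Submission
  imports Defs
begin

text \<open>
  Both defining conditions of the model persist under the gradient field
  \<open>(Xh - B ** \<sigma> Xh ** B) / 4\<close>, and at the critical point \<open>A\<close> this field vanishes, which makes
  \<open>H = adj A ** Xh\<close> Hermitian. Writing \<open>\<beta> t = S t ** adj A\<close>, the curve is
  \<open>\<alpha> t = A ** cayley (mat 1) (S t)\<close> with \<open>S t\<close> skew-Hermitian and
  \<open>S' = - (H ** S + S ** H) / 4\<close>; since \<open>cayley (mat 1) S = 2 (mat 1 + S)^-1 - mat 1\<close>, the
  gradient equation reduces to an algebraic identity. That \<open>\<sigma>\<close> preserves the trace form follows
  from the uniqueness of a trace functional invariant under \<open>adj\<close>.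
\<close>

section \<open>Conjugation and real part\<close>

text \<open>The factor 1/4 comes from projecting the ambient gradient \<open>adj X\<close> of
  \<open>height X\<close> onto the tangent space at \<open>B\<close>, which is the common fixed
  space of two commuting isometric reflections: \<open>Y\<close> to \<open>adj (\<sigma> Y)\<close>
  and \<open>Y\<close> to \<open>- (B ** adj Y ** B)\<close>. Averaging over the first gives
  \<open>Xh / 2\<close>, averaging that over the second gives the field. Invariance of the trace
  form under \<open>\<sigma>\<close> is what makes the first reflection isometric. Since
  \<open>H\<close> is Hermitian, so are the exponentials on both sides of \<open>S 0\<close>; thus
  \<open>S t\<close> is a congruence of \<open>S 0\<close> and stays skew-Hermitian. For such a
  matrix \<open>mat 1 + S t\<close> is never singular, so the curve stays in the chart and exists
  for all times. Unitarity and \<open>\<sigma> B = adj B\<close> describe a set that can have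
  further components besides the model. Staying in the model therefore needs its own
  argument.\<close>

lemma kRe_eqI: "x + kcnj x = (2 * r) *\<^sub>R 1 \<Longrightarrow> kRe x = r" for x :: "'k::rch_algebra"
  by (simp add: add_kcnj)

lemma kcnj_zero [simp]: "kcnj (0::'k::rch_algebra) = 0"
  using kcnj_scaleR[of 0 "0::'k"] by simp

lemma kcnj_one [simp]: "kcnj (1::'k::rch_algebra) = 1"
  using mult_kcnj[of "1::'k"] by simp

lemma kcnj_sum: "kcnj (sum f I) = (\<Sum>i\<in>I. kcnj (f i))" for f :: "'i \<Rightarrow> 'k::rch_algebra"
  by (induction I rule: infinite_finite_induct) (simp_all add: kcnj_add)

lemma kRe_add: "kRe (x + y) = kRe x + kRe y" for x :: "'k::rch_algebra"
  by (rule kRe_eqI) (simp add: kcnj_add distrib_left scaleR_left_distrib add_ac flip: add_kcnj)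

lemma kRe_scaleR: "kRe (r *\<^sub>R x) = r * kRe x" for x :: "'k::rch_algebra"
proof (rule kRe_eqI)
  have "r *\<^sub>R x + kcnj (r *\<^sub>R x) = r *\<^sub>R (x + kcnj x)"
    by (simp add: kcnj_scaleR scaleR_right_distrib)
  then show "r *\<^sub>R x + kcnj (r *\<^sub>R x) = (2 * (r * kRe x)) *\<^sub>R 1"
    by (simp add: add_kcnj mult_ac)
qed

lemma linear_kRe: "linear (kRe :: 'k::rch_algebra \<Rightarrow> real)"
  by (rule linearI) (simp_all add: kRe_add kRe_scaleR)

lemma kRe_kcnj [simp]: "kRe (kcnj x) = kRe x" for x :: "'k::rch_algebra"
  by (rule kRe_eqI) (simp add: kcnj_kcnj add.commute flip: add_kcnj)

lemma kRe_one [simp]: "kRe (1::'k::rch_algebra) = 1"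
  by (rule kRe_eqI) (simp add: scaleR_2)

lemma kRe_of_nat: "kRe (of_nat m :: 'k::rch_algebra) = m"
  using kRe_scaleR[of "real m" "1::'k"] by (simp add: scaleR_conv_of_real)

text \<open>The inverse is a real multiple of \<open>kcnj a\<close>, so conjugation by
  \<open>a\<close> commutes with \<open>kcnj\<close>; and it fixes \<open>x + kcnj x\<close>, a real
  scalar.\<close>

lemma kRe_conjugate:
  fixes a x :: "'k::rch_algebra"
  assumes "a \<noteq> 0"
  shows "kRe (a * x * inverse a) = kRe x"
proof -
  have na: "norm a ^ 2 \<noteq> 0" using assms by simp
  have inv: "inverse a = kcnj a /\<^sub>R (norm a)\<^sup>2"
    using assms na by (intro inverse_unique) (simp add: mult_kcnj)
  have "kcnj (a * x * inverse a) = a * kcnj x * inverse a"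
    by (simp add: inv kcnj_mult kcnj_scaleR kcnj_kcnj mult.assoc)
  then have "a * x * inverse a + kcnj (a * x * inverse a) = a * (x + kcnj x) * inverse a"
    by (simp add: distrib_left distrib_right)
  also have "\<dots> = (2 * kRe x) *\<^sub>R 1"
    using assms by (simp add: add_kcnj)
  finally show ?thesis by (rule kRe_eqI)
qed

text \<open>\<open>x * y\<close> is the conjugate of \<open>y * x\<close> by \<open>x\<close>. In
  the trace identities this takes the place of commutativity of the scalars.\<close>

lemma kRe_mult_commute: "kRe (x * y) = kRe (y * x)" for x :: "'k::rch_algebra"
proof (cases "x = 0")
  case False
  then show ?thesis using kRe_conjugate[of x "y * x"] by (simp add: mult.assoc)
qed simp

lemma kRe_kcnj_mult: "kRe (kcnj x * x) = (norm x)\<^sup>2" for x :: "'k::rch_algebra"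
  by (subst kRe_mult_commute) (simp add: mult_kcnj kRe_scaleR)

section \<open>Matrix algebra\<close>

lemma adj_nth [simp]: "adj A $ i $ j = kcnj (A $ j $ i)"
  by (simp add: adj_def)

lemma adj_adj [simp]: "adj (adj A) = A"
  by (simp add: vec_eq_iff kcnj_kcnj)

lemma adj_add: "adj (A + B) = adj A + adj B"
  by (simp add: vec_eq_iff kcnj_add)

lemma adj_scaleR: "adj (r *\<^sub>R A) = r *\<^sub>R adj A"
  by (simp add: vec_eq_iff kcnj_scaleR)

lemma linear_adj: "linear adj"
  by (rule linearI) (simp_all add: adj_add adj_scaleR)

lemma adj_diff: "adj (A - B) = adj A - adj B"
  by (rule linear_diff[OF linear_adj])

lemma adj_minus: "adj (- A) = - adj A"
  by (rule linear_neg[OF linear_adj])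

lemma adj_mat_1 [simp]: "adj (mat 1) = mat 1"
  by (auto simp: vec_eq_iff mat_def)

lemma adj_mult: "adj (A ** B) = adj B ** adj A"
  by (simp add: vec_eq_iff matrix_matrix_mult_def kcnj_sum kcnj_mult)

lemma bounded_bilinear_matrix_mult:
  "bounded_bilinear ((**) :: 'k::rch_algebra^'n^'m \<Rightarrow> 'k^'p^'n \<Rightarrow> 'k^'p^'m)"
  unfolding bilinear_conv_bounded_bilinear[symmetric] bilinear_def
  by (intro conjI allI linearI)
    (simp_all add: vec_eq_iff matrix_matrix_mult_def distrib_left distrib_right sum.distrib
      scaleR_sum_right)

text \<open>Provides limits, continuity and product rules for \<open>**\<close>; the ring operation
  \<open>*\<close> on matrices is the componentwise product.\<close>

interpretation mm: bounded_bilinear "(**) :: 'k::rch_algebra^'n^'m \<Rightarrow> 'k^'p^'n \<Rightarrow> 'k^'p^'m"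
  by (rule bounded_bilinear_matrix_mult)

text \<open>Normal form: sums expanded, \<open>adj\<close> pushed to the factors, products nested to
  the right.\<close>

lemmas matrix_ring_simps =
  mm.add_left mm.add_right mm.diff_left mm.diff_right mm.minus_left mm.minus_right
  mm.scaleR_left mm.scaleR_right mm.zero_left mm.zero_right matrix_mul_assoc[symmetric]
  adj_add adj_diff adj_minus adj_scaleR adj_mult

lemma bounded_linear_adj: "bounded_linear (adj :: 'k::rch_algebra^'n^'m \<Rightarrow> 'k^'m^'n)"
  by (rule linear_conv_bounded_linear[THEN iffD1, OF linear_adj])

section \<open>The trace form\<close>

lemma re_tr_mult: "re_tr (A ** B) = (\<Sum>i\<in>UNIV. \<Sum>j\<in>UNIV. kRe (A $ i $ j * B $ j $ i))"
  by (simp add: re_tr_def trace_def matrix_matrix_mult_def linear_sum[OF linear_kRe])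

lemma re_tr_mult_commute: "re_tr (A ** B) = re_tr (B ** A)"
  unfolding re_tr_mult by (subst sum.swap) (simp add: kRe_mult_commute)

lemma linear_re_tr: "linear re_tr"
  by (rule linearI)
    (simp_all add: re_tr_def trace_def sum.distrib kRe_add kRe_scaleR scaleR_sum_right[symmetric])

lemmas re_tr_linear_simps =
  linear_add[OF linear_re_tr] linear_diff[OF linear_re_tr] linear_neg[OF linear_re_tr]
  linear_0[OF linear_re_tr] linear_cmul[OF linear_re_tr]

lemma re_tr_adj: "re_tr (adj A) = re_tr A"
  by (simp add: re_tr_def trace_def linear_sum[OF linear_kRe])

text \<open>The norm of nested vectors is the Frobenius norm, so it belongs to the trace
  form.\<close>

lemma norm_matrix_squared: "(norm A)\<^sup>2 = re_tr (adj A ** A)" for A :: "'k::rch_algebra^'n^'n"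
proof -
  have "(norm A)\<^sup>2 = (\<Sum>i\<in>UNIV. \<Sum>j\<in>UNIV. (norm (A $ i $ j))\<^sup>2)"
    by (simp add: norm_vec_def L2_set_def sum_nonneg)
  also have "\<dots> = re_tr (adj A ** A)"
    unfolding re_tr_mult by (subst sum.swap) (simp add: kRe_kcnj_mult)
  finally show ?thesis .
qed

section \<open>Matrix units and the uniqueness of the trace\<close>

definition unit_mat :: "'k::rch_algebra \<Rightarrow> 'n \<Rightarrow> 'n \<Rightarrow> 'k^'n^'n" where
  "unit_mat a i j = (\<chi> k l. if k = i \<and> l = j then a else 0)"

lemma unit_mat_mult:
  "unit_mat a i j ** unit_mat b k l = (if j = k then unit_mat (a * b) i l else 0)"
proof -
  have "(\<Sum>m\<in>UNIV. unit_mat a i j $ p $ m * unit_mat b k l $ m $ q) =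
      (if p = i then a * unit_mat b k l $ j $ q else 0)" for p q
  proof -
    have "unit_mat a i j $ p $ m * unit_mat b k l $ m $ q =
        (if j = m then if p = i then a * unit_mat b k l $ j $ q else 0 else 0)" for m
      by (simp add: unit_mat_def)
    then show ?thesis by (simp add: sum.delta)
  qed
  then have "(unit_mat a i j ** unit_mat b k l) $ p $ q =
      (if p = i then a * unit_mat b k l $ j $ q else 0)" for p q
    by (simp add: matrix_matrix_mult_def)
  also have "\<dots> p q = (if j = k then unit_mat (a * b) i l else 0) $ p $ q" for p q
    by (simp add: unit_mat_def)
  finally show ?thesis unfolding vec_eq_iff by blast
qed

lemma adj_unit_mat: "adj (unit_mat a i j) = unit_mat (kcnj a) j i"
  by (auto simp: vec_eq_iff unit_mat_def)

lemma matrix_eq_sum_unit_mat: "A = (\<Sum>i\<in>UNIV. \<Sum>j\<in>UNIV. unit_mat (A $ i $ j) i j)"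
proof -
  have "(\<Sum>i\<in>UNIV. \<Sum>j\<in>UNIV. unit_mat (A $ i $ j) i j $ k $ l) = A $ k $ l" for k l
  proof -
    have "(\<Sum>j\<in>UNIV. unit_mat (A $ i $ j) i j $ k $ l) = (if i = k then A $ k $ l else 0)" for i
      by (auto simp: unit_mat_def intro!: sum.neutral)
    then show ?thesis by simp
  qed
  then show ?thesis by (simp add: vec_eq_iff)
qed

text \<open>Commuting factors force the value 0 on off-diagonal matrix units and equal values along
  the diagonal. Invariance under \<open>adj\<close> leaves only a multiple of the real part of an
  entry, and the value at \<open>mat 1\<close> fixes that multiple.\<close>

lemma re_tr_unique:
  fixes \<phi> :: "'k::rch_algebra^'n^'n \<Rightarrow> real"
  assumes lin: "linear \<phi>" and comm: "\<And>A B. \<phi> (A ** B) = \<phi> (B ** A)"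
    and adj: "\<And>A. \<phi> (adj A) = \<phi> A" and one: "\<phi> (mat 1) = CARD('n)"
  shows "\<phi> A = re_tr A"
proof -
  have off: "\<phi> (unit_mat a i j) = 0" if "i \<noteq> j" for a i j
    using comm[of "unit_mat 1 i i" "unit_mat a i j"] that
    by (simp add: unit_mat_mult linear_0[OF lin])
  have diag: "\<phi> (unit_mat a i i) = \<phi> (unit_mat a j j)" for a i j
    using comm[of "unit_mat a i j" "unit_mat 1 j i"] by (simp add: unit_mat_mult)
  have "mat 1 = (\<Sum>i\<in>UNIV. unit_mat (1::'k) i i :: 'k^'n^'n)"
    by (auto simp: vec_eq_iff mat_def unit_mat_def intro!: sum.neutral)
  then have "(\<Sum>i::'n\<in>UNIV. \<phi> (unit_mat 1 i i)) = CARD('n)"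
    using one by (simp add: linear_sum[OF lin])
  moreover have "(\<Sum>i::'n\<in>UNIV. \<phi> (unit_mat 1 i i)) = CARD('n) * \<phi> (unit_mat 1 j j)" for j
    by (subst sum.cong[OF refl diag[of 1 _ j]]) simp_all
  ultimately have unit: "\<phi> (unit_mat 1 i i) = 1" for i
    using mult_cancel_left1 by (metis of_nat_0_eq_iff zero_less_card_finite less_irrefl)
  have real: "\<phi> (unit_mat a i i) = kRe a" for a i
  proof -
    have "unit_mat a i i + adj (unit_mat a i i) = (2 * kRe a) *\<^sub>R unit_mat 1 i i"
      by (simp add: adj_unit_mat vec_eq_iff unit_mat_def add_kcnj)
    then have "\<phi> (unit_mat a i i) + \<phi> (adj (unit_mat a i i)) = 2 * kRe a"
      by (simp add: unit linear_cmul[OF lin] flip: linear_add[OF lin])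
    then show ?thesis by (simp add: adj)
  qed
  have "\<phi> A = (\<Sum>i\<in>UNIV. \<Sum>j\<in>UNIV. \<phi> (unit_mat (A $ i $ j) i j))"
    using arg_cong[OF matrix_eq_sum_unit_mat[of A], of \<phi>] by (simp only: linear_sum[OF lin])
  also have "\<dots> = (\<Sum>i\<in>UNIV. \<Sum>j\<in>UNIV. if j = i then kRe (A $ i $ i) else 0)"
    by (intro sum.cong refl) (simp add: real off)
  finally have "\<phi> A = (\<Sum>i\<in>UNIV. kRe (A $ i $ i))" by simp
  then show ?thesis by (simp add: re_tr_def trace_def linear_sum[OF linear_kRe])
qed

section \<open>Inverses of matrices\<close>

text \<open>Matrices over a skew field have no determinant; dimension counting over the reals replaces it.\<close>

lemma injective_mult_imp_right_inverse:
  fixes A :: "'k::rch_algebra^'n^'n"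
  assumes "\<And>Y :: 'k^'n^'n. A ** Y = 0 \<Longrightarrow> Y = 0"
  obtains B where "A ** B = mat 1" "B ** A = mat 1"
proof -
  have lin: "linear ((**) A :: 'k^'n^'n \<Rightarrow> 'k^'n^'n)"
    by (rule bounded_linear.linear[OF mm.bounded_linear_right])
  have inj: "inj ((**) A :: 'k^'n^'n \<Rightarrow> 'k^'n^'n)"
    unfolding linear_injective_0[OF lin] using assms by blast
  then have "surj ((**) A :: 'k^'n^'n \<Rightarrow> 'k^'n^'n)"
    by (rule linear_inj_imp_surj[OF lin])
  then obtain B where B: "A ** B = mat 1" by (metis surjD)
  \<comment> \<open>Injectivity cancels the left factor \<open>A\<close>, so the right inverse is
    also a left inverse.\<close>
  have "A ** (B ** A) = A ** mat 1" by (simp add: matrix_mul_assoc B)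
  then show ?thesis using B inj that by (meson injD)
qed

lemma matrix_left_inverse_imp_right_inverse:
  fixes A B :: "'k::rch_algebra^'n^'n"
  assumes "B ** A = mat 1"
  shows "A ** B = mat 1"
proof -
  have "Y = 0" if "A ** Y = 0" for Y :: "'k^'n^'n"
    using that assms by (metis matrix_mul_assoc matrix_mul_lid mm.zero_right)
  then obtain C where "A ** C = mat 1" by (rule injective_mult_imp_right_inverse)
  then show ?thesis using assms by (metis matrix_mul_assoc matrix_mul_lid matrix_mul_rid)
qed

lemma matrix_inv_mult:
  assumes "invertible A"
  shows "A ** matrix_inv A = mat 1" "matrix_inv A ** A = mat 1"
  using someI_ex[OF assms[unfolded invertible_def]] unfolding matrix_inv_def by blast+

lemma matrix_inv_eqI:
  fixes A B :: "'k::rch_algebra^'n^'n"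
  assumes "A ** B = mat 1"
  shows "matrix_inv A = B"
proof -
  have "invertible A"
    using assms matrix_left_inverse_imp_right_inverse invertible_def by blast
  then show ?thesis
    using assms by (metis matrix_inv_mult(2) matrix_mul_assoc matrix_mul_lid matrix_mul_rid)
qed

text \<open>Pythagoras: \<open>Y\<close> and \<open>S ** Y\<close> are orthogonal for the trace form
  when \<open>S\<close> is skew-Hermitian.\<close>

lemma norm_add_skew_mult:
  fixes S Y :: "'k::rch_algebra^'n^'n"
  assumes "adj S = - S"
  shows "norm Y \<le> norm ((mat 1 + S) ** Y)"
proof -
  have "adj (adj Y ** S ** Y) = - (adj Y ** S ** Y)"
    by (simp add: matrix_ring_simps assms)
  then have skew: "re_tr (adj Y ** S ** Y) = 0"
    using re_tr_adj[of "adj Y ** S ** Y"] by (simp add: re_tr_linear_simps)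
  have "adj ((mat 1 + S) ** Y) ** ((mat 1 + S) ** Y) = adj Y ** Y + adj (S ** Y) ** (S ** Y)"
    by (simp add: matrix_ring_simps assms)
  then have "(norm ((mat 1 + S) ** Y))\<^sup>2 = (norm Y)\<^sup>2 + (norm (S ** Y))\<^sup>2"
    by (simp add: norm_matrix_squared re_tr_linear_simps)
  then show ?thesis by (metis le_add_same_cancel1 norm_ge_zero power2_le_imp_le zero_le_power2)
qed

text \<open>The estimate for \<open>(mat 1 + S) ** Y\<close> gives injectivity, and with the inverse
  as \<open>Y\<close> it bounds that inverse by a constant independent of \<open>S\<close>.\<close>

lemma
  fixes S :: "'k::rch_algebra^'n^'n"
  assumes "adj S = - S"
  shows invertible_add_skew: "invertible (mat 1 + S)"
    and norm_inv_add_skew: "norm (matrix_inv (mat 1 + S)) \<le> norm (mat 1 :: 'k^'n^'n)"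
proof -
  show inv: "invertible (mat 1 + S)"
  proof (rule injective_mult_imp_right_inverse[of "mat 1 + S"])
    show "Y = 0" if "(mat 1 + S) ** Y = 0" for Y :: "'k^'n^'n"
      using norm_add_skew_mult[OF assms, of Y] that by simp
  qed (auto simp: invertible_def)
  show "norm (matrix_inv (mat 1 + S)) \<le> norm (mat 1 :: 'k^'n^'n)"
    using norm_add_skew_mult[OF assms, of "matrix_inv (mat 1 + S)"] matrix_inv_mult[OF inv] by simp
qed

section \<open>The exponential\<close>

lemma mat_pow_0 [simp]: "mat_pow A 0 = mat 1"
  by (simp add: mat_pow_def)

lemma mat_pow_Suc: "mat_pow A (Suc m) = A ** mat_pow A m"
  by (simp add: mat_pow_def)

lemma mat_pow_Suc_right: "mat_pow A (Suc m) = mat_pow A m ** A"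
proof (induction m)
  case (Suc m)
  have "mat_pow A (Suc (Suc m)) = A ** (mat_pow A m ** A)"
    by (simp add: mat_pow_Suc[of A "Suc m"] Suc)
  then show ?case by (simp add: mat_pow_Suc matrix_mul_assoc)
qed (simp add: mat_pow_Suc)

lemma mat_pow_scaleR: "mat_pow (r *\<^sub>R A) m = r ^ m *\<^sub>R mat_pow A m"
  by (induction m) (simp_all add: mat_pow_Suc mm.scaleR_left mm.scaleR_right)

lemma norm_mat_pow_le:
  fixes A :: "'k::rch_algebra^'n^'n"
  obtains K where "\<And>m. norm (mat_pow A m) \<le> norm (mat 1 :: 'k^'n^'n) * K ^ m"
proof -
  \<comment> \<open>Submultiplicativity up to a constant is enough: the constant is absorbed into
    the base of the power.\<close>
  obtain K where K: "\<And>(a :: 'k^'n^'n) (b :: 'k^'n^'n). norm (a ** b) \<le> norm a * norm b * K" "K \<ge> 0"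
    using mm.nonneg_bounded by blast
  have "norm (mat_pow A m) \<le> norm (mat 1 :: 'k^'n^'n) * (norm A * K) ^ m" for m
  proof (induction m)
    case (Suc m)
    have "norm (mat_pow A (Suc m)) \<le> norm A * norm (mat_pow A m) * K"
      using K(1)[of A "mat_pow A m"] by (simp add: mat_pow_Suc)
    also have "\<dots> \<le> norm A * (norm (mat 1 :: 'k^'n^'n) * (norm A * K) ^ m) * K"
      using Suc K(2) by (intro mult_right_mono mult_left_mono) auto
    finally show ?case by (simp add: mult_ac)
  qed simp
  then show ?thesis using that by blast
qed

lemma summable_mat_exp:
  fixes A :: "'k::rch_algebra^'n^'n"
  shows "summable (\<lambda>m. mat_pow A m /\<^sub>R fact m)"
proof -
  obtain K where K: "\<And>m. norm (mat_pow A m) \<le> norm (mat 1 :: 'k^'n^'n) * K ^ m"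
    using norm_mat_pow_le by blast
  have "summable (\<lambda>m. norm (mat 1 :: 'k^'n^'n) * (inverse (fact m) * K ^ m))"
    by (rule summable_mult[OF summable_exp])
  moreover have "norm (mat_pow A m /\<^sub>R fact m) \<le> norm (mat 1 :: 'k^'n^'n) * (inverse (fact m) * K ^ m)" for m
    using mult_left_mono[OF K[of m], of "inverse (fact m)"] by (simp add: mult_ac)
  ultimately show ?thesis by (rule summable_comparison_test'[where N=0])
qed

text \<open>Linear maps are continuous in finite dimension and pass through the series, so
  identities between exponentials reduce to identities between powers.\<close>

lemma mat_exp_transfer:
  fixes f g :: "'k::rch_algebra^'n^'n \<Rightarrow> 'v::real_normed_vector"
  assumes "linear f" "linear g" "\<And>m. f (mat_pow A m) = g (mat_pow B m)"
  shows "f (mat_exp A) = g (mat_exp B)"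
proof -
  have "bounded_linear f" "bounded_linear g"
    using assms linear_conv_bounded_linear by blast+
  then show ?thesis
    unfolding mat_exp_def
    by (simp add: bounded_linear.suminf[OF _ summable_mat_exp] linear_cmul[OF assms(1)]
        linear_cmul[OF assms(2)] assms(3))
qed

lemma linear_mult_left: "linear (\<lambda>E. A ** E)" for A :: "'k::rch_algebra^'n^'m"
  by (rule bounded_linear.linear[OF mm.bounded_linear_right])

lemma linear_mult_right: "linear (\<lambda>E. E ** A)" for A :: "'k::rch_algebra^'n^'m"
  by (rule bounded_linear.linear[OF mm.bounded_linear_left])

text \<open>Used with \<open>P\<close> unitary to move one exponential of the curve to the other
  side of \<open>A\<close>, and with \<open>P = H\<close> to commute \<open>H\<close> with its own
  exponential.\<close>

lemma mat_exp_intertwine: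
  fixes A B P :: "'k::rch_algebra^'n^'n"
  assumes "P ** A = B ** P"
  shows "P ** mat_exp A = mat_exp B ** P"
proof (rule mat_exp_transfer[OF linear_mult_left linear_mult_right])
  show "P ** mat_pow A m = mat_pow B m ** P" for m
    by (induction m) (simp_all add: mat_pow_Suc matrix_mul_assoc assms, simp flip: matrix_mul_assoc)
qed

text \<open>Powers of a single matrix do not notice the reversal of factors. Serves for
  \<open>adj\<close> and for the anti-automorphism that encodes \<open>\<sigma> Y = adj Y\<close> in
  the chart.\<close>

lemma mat_exp_antihom:
  fixes f :: "'k::rch_algebra^'n^'n \<Rightarrow> 'k^'n^'n"
  assumes "linear f" "f (mat 1) = mat 1" "\<And>Y Z. f (Y ** Z) = f Z ** f Y"
  shows "f (mat_exp A) = mat_exp (f A)"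
proof (rule mat_exp_transfer[OF assms(1) linear_id[unfolded id_def]])
  show "f (mat_pow A m) = mat_pow (f A) m" for m
    by (induction m) (simp_all add: mat_pow_Suc_right[of A] mat_pow_Suc[of "f A"] assms)
qed

lemma mat_exp_0 [simp]: "mat_exp 0 = (mat 1 :: 'k::rch_algebra^'n^'n)"
proof -
  have "mat_pow 0 m /\<^sub>R fact m = (if m = 0 then mat 1 :: 'k^'n^'n else 0)" for m
    by (cases m) (simp_all add: mat_pow_Suc mm.zero_left)
  then show ?thesis
    using sums_single[of 0 "\<lambda>_. mat 1 :: 'k^'n^'n"] by (simp only: mat_exp_def sums_unique[symmetric])
qed

text \<open>Each coordinate is a real power series in \<open>s\<close> converging everywhere, so it
  may be differentiated term by term.\<close>

lemma has_vector_derivative_mat_exp: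
  fixes H :: "'k::rch_algebra^'n^'n"
  shows "((\<lambda>s. mat_exp (s *\<^sub>R H)) has_vector_derivative H ** mat_exp (s *\<^sub>R H)) (at s)"
  unfolding has_vector_derivative_def
proof (rule has_derivative_componentwise_within[THEN iffD2, rule_format])
  fix b :: "'k^'n^'n" assume "b \<in> Basis"
  define c where "c m = (mat_pow H m \<bullet> b) / fact m" for m
  have bl: "bounded_linear (\<lambda>Y::'k^'n^'n. Y \<bullet> b)" by (rule bounded_linear_inner_left)
  have lin: "bounded_linear (\<lambda>E. H ** E)" by (rule mm.bounded_linear_right)
  have c: "(\<lambda>m. c m * x ^ m) sums (mat_exp (x *\<^sub>R H) \<bullet> b)" for x
  proof -
    have "c m * x ^ m = (mat_pow (x *\<^sub>R H) m /\<^sub>R fact m) \<bullet> b" for m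
      by (simp add: c_def mat_pow_scaleR divide_inverse mult_ac)
    then show ?thesis
      using bounded_linear.sums[OF bl summable_sums[OF summable_mat_exp]]
      by (simp add: mat_exp_def)
  qed
  have d: "(\<lambda>m. diffs c m * x ^ m) sums ((H ** mat_exp (x *\<^sub>R H)) \<bullet> b)" for x
  proof -
    have "diffs c m * x ^ m = (H ** (mat_pow (x *\<^sub>R H) m /\<^sub>R fact m)) \<bullet> b" for m
      by (simp add: c_def diffs_def mat_pow_scaleR mat_pow_Suc mm.scaleR_right fact_Suc divide_simps)
    then show ?thesis
      using bounded_linear.sums[OF bl bounded_linear.sums[OF lin summable_sums[OF summable_mat_exp]]]
      by (simp add: mat_exp_def)
  qed
  have "((\<lambda>x. \<Sum>m. c m * x ^ m) has_real_derivative (\<Sum>m. diffs c m * s ^ m)) (at s)"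
    using c by (intro termdiffs_strong_converges_everywhere) (blast dest: sums_summable)
  then have "((\<lambda>x. mat_exp (x *\<^sub>R H) \<bullet> b) has_real_derivative (H ** mat_exp (s *\<^sub>R H)) \<bullet> b) (at s)"
    by (simp add: sums_unique[OF c, symmetric] sums_unique[OF d, symmetric])
  then show "((\<lambda>x. mat_exp (x *\<^sub>R H) \<bullet> b) has_derivative
      (\<lambda>x. (x *\<^sub>R (H ** mat_exp (s *\<^sub>R H))) \<bullet> b)) (at s)"
    by (simp add: has_field_derivative_def mult_commute_abs)
qed

section \<open>Cayley transform and unitary matrices\<close>

text \<open>The last two forms cancel inside products nested to the right, the shape that
  \<open>matrix_ring_simps\<close> produces.\<close>

lemma orth_grpD:
  fixes A :: "'k::rch_algebra^'n^'n"
  assumes "A \<in> orth_grp"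
  shows "A ** adj A = mat 1" "adj A ** A = mat 1"
    "\<And>Y. A ** (adj A ** Y) = Y" "\<And>Y. adj A ** (A ** Y) = Y"
proof -
  show *: "A ** adj A = mat 1" "adj A ** A = mat 1"
    using assms matrix_left_inverse_imp_right_inverse by (auto simp: orth_grp_def)
  show "A ** (adj A ** Y) = Y" "adj A ** (A ** Y) = Y" for Y
    using * by (simp_all add: matrix_mul_assoc)
qed

lemma orth_grp_mult:
  assumes "A \<in> orth_grp" "B \<in> orth_grp"
  shows "A ** B \<in> orth_grp"
  by (simp add: orth_grp_def matrix_ring_simps orth_grpD[OF assms(1)] orth_grpD[OF assms(2)])

lemma orth_grp_adj: "A \<in> orth_grp \<Longrightarrow> adj A \<in> orth_grp"
  using orth_grpD(2) unfolding orth_grp_def by force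

lemma mat_1_in_orth_grp: "mat 1 \<in> orth_grp"
  by (simp add: orth_grp_def)

lemma norm_orth_grp_mult:
  fixes Y :: "'k::rch_algebra^'n^'n"
  assumes "A \<in> orth_grp"
  shows "norm (A ** Y) = norm Y" "norm (Y ** A) = norm Y"
proof -
  have "(norm (A ** Y))\<^sup>2 = (norm Y)\<^sup>2"
    by (simp add: norm_matrix_squared matrix_ring_simps orth_grpD[OF assms])
  then show "norm (A ** Y) = norm Y" by simp
  have "(norm (Y ** A))\<^sup>2 = re_tr (adj A ** (adj Y ** Y ** A))"
    by (simp add: norm_matrix_squared matrix_ring_simps)
  also have "\<dots> = (norm Y)\<^sup>2"
    by (subst re_tr_mult_commute) (simp add: norm_matrix_squared matrix_ring_simps orth_grpD[OF assms])
  finally show "norm (Y ** A) = norm Y" by simp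
qed

lemma cayley_mat_1:
  assumes "invertible (mat 1 + S)"
  shows "cayley (mat 1) S = 2 *\<^sub>R matrix_inv (mat 1 + S) - mat 1"
proof -
  have "mat 1 - S = 2 *\<^sub>R mat 1 - (mat 1 + S)" by (simp add: scaleR_2)
  then show ?thesis
    by (simp only: cayley_def adj_mat_1 matrix_mul_lid mm.diff_left mm.scaleR_left
        matrix_inv_mult[OF assms])
qed

text \<open>For \<open>Q\<close> the inverse of \<open>mat 1 + U\<close>, unitarity of
  \<open>U\<close> gives \<open>adj Q + Q = mat 1\<close>, so \<open>2 *\<^sub>R Q - mat 1\<close>
  is skew-Hermitian.\<close>

lemma cayley_mat_1_skew:
  fixes U :: "'k::rch_algebra^'n^'n"
  assumes "U \<in> orth_grp" "invertible (mat 1 + U)"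
  shows "adj (cayley (mat 1) U) = - cayley (mat 1) U"
proof -
  define Q where "Q = matrix_inv (mat 1 + U)"
  have Q: "(mat 1 + U) ** Q = mat 1" "Q ** (mat 1 + U) = mat 1"
    unfolding Q_def by (rule matrix_inv_mult[OF assms(2)])+
  have Q': "adj Q ** (mat 1 + adj U) = mat 1"
    using arg_cong[OF Q(1), of adj] by (simp add: matrix_ring_simps)
  have "adj Q ** adj U = adj Q ** adj U ** ((mat 1 + U) ** Q)"
    by (simp add: Q)
  also have "\<dots> = adj Q ** (mat 1 + adj U) ** Q"
    by (simp add: matrix_ring_simps orth_grpD[OF assms(1)] add.commute)
  finally have "adj Q ** adj U = Q" by (simp add: Q')
  then have "adj Q + Q = mat 1" using Q' by (simp add: matrix_ring_simps)
  then have "adj Q = mat 1 - Q" by (simp add: eq_diff_eq)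
  then show ?thesis
    by (simp add: cayley_mat_1[OF assms(2)] matrix_ring_simps scaleR_diff_right scaleR_2 flip: Q_def)
qed

text \<open>Inserting \<open>(mat 1 - S) + (mat 1 + S)\<close> between \<open>R\<close> and
  \<open>adj R\<close> yields \<open>R + adj R = 2 *\<^sub>R (R ** adj R)\<close>, exactly the
  cancellation needed when \<open>2 *\<^sub>R R - mat 1\<close> is multiplied by its
  adjoint.\<close>

lemma cayley_mat_1_orth:
  fixes S :: "'k::rch_algebra^'n^'n"
  assumes "adj S = - S"
  shows "cayley (mat 1) S \<in> orth_grp"
proof -
  define R where "R = matrix_inv (mat 1 + S)"
  note inv = invertible_add_skew[OF assms]
  have R: "(mat 1 + S) ** R = mat 1" "R ** (mat 1 + S) = mat 1"
    unfolding R_def by (rule matrix_inv_mult[OF inv])+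
  have R': "adj R ** (mat 1 - S) = mat 1" "(mat 1 - S) ** adj R = mat 1"
    using arg_cong[OF R(1), of adj] arg_cong[OF R(2), of adj] by (simp_all add: matrix_ring_simps assms)
  have "R + adj R = R ** ((mat 1 - S) ** adj R) + (R ** (mat 1 + S)) ** adj R"
    by (simp only: R R' matrix_mul_lid matrix_mul_rid)
  also have "\<dots> = 2 *\<^sub>R (R ** adj R)"
    by (simp add: matrix_ring_simps scaleR_2)
  finally have "4 *\<^sub>R (R ** adj R) = 2 *\<^sub>R R + 2 *\<^sub>R adj R"
    by (simp flip: scaleR_add_right)
  then show ?thesis
    by (simp add: orth_grp_def cayley_mat_1[OF inv] matrix_ring_simps scaleR_diff_right flip: R_def)
qed

lemma cayley_mat_1_involution:
  fixes U :: "'k::rch_algebra^'n^'n"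
  assumes "invertible (mat 1 + U)"
  shows "cayley (mat 1) (cayley (mat 1) U) = U"
proof -
  define Q where "Q = matrix_inv (mat 1 + U)"
  \<comment> \<open>The inverse of \<open>2 *\<^sub>R Q\<close> is half of \<open>mat 1 + U\<close>;
    doubling it and subtracting \<open>mat 1\<close> returns \<open>U\<close>.\<close>
  have S: "mat 1 + cayley (mat 1) U = 2 *\<^sub>R Q"
    by (simp add: cayley_mat_1[OF assms] Q_def)
  have *: "(2 *\<^sub>R Q) ** ((1/2) *\<^sub>R (mat 1 + U)) = mat 1"
    by (simp only: mm.scaleR_left mm.scaleR_right Q_def matrix_inv_mult[OF assms]) simp
  then have inv: "invertible (mat 1 + cayley (mat 1) U)"
    unfolding S invertible_def using matrix_left_inverse_imp_right_inverse by blast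
  show ?thesis
    unfolding cayley_mat_1[OF inv] unfolding S matrix_inv_eqI[OF *] by simp
qed

text \<open>In the form \<open>2 (mat 1 + U)^-1 - mat 1\<close> there is no product whose order
  could be reversed, and an anti-homomorphism respects inverses.\<close>

lemma cayley_mat_1_antihom:
  fixes f :: "'k::rch_algebra^'n^'n \<Rightarrow> 'k^'n^'n"
  assumes "linear f" "f (mat 1) = mat 1" "\<And>Y Z. f (Y ** Z) = f Z ** f Y"
    and inv: "invertible (mat 1 + U)"
  shows "f (cayley (mat 1) U) = cayley (mat 1) (f U)"
proof -
  define Q where "Q = matrix_inv (mat 1 + U)"
  have *: "(mat 1 + f U) ** f Q = mat 1"
    using arg_cong[OF matrix_inv_mult(2)[OF inv], of f]
    by (simp add: assms(2,3) linear_add[OF assms(1)] flip: Q_def)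
  then have "invertible (mat 1 + f U)"
    unfolding invertible_def using matrix_left_inverse_imp_right_inverse by blast
  then show ?thesis
    by (simp add: cayley_mat_1 inv matrix_inv_eqI[OF *] assms(2) linear_diff[OF assms(1)]
        linear_cmul[OF assms(1)] flip: Q_def)
qed

text \<open>Factoring \<open>A + Y\<close> as \<open>A ** (mat 1 + adj A ** Y)\<close> moves the
  centre of the transform to the identity.\<close>

lemma cayley_orth_eq:
  fixes A Y :: "'k::rch_algebra^'n^'n"
  assumes "A \<in> orth_grp" "invertible (A + Y)"
  shows "invertible (mat 1 + adj A ** Y)" "cayley A Y = cayley (mat 1) (adj A ** Y) ** adj A"
proof -
  have *: "(mat 1 + adj A ** Y) ** (matrix_inv (A + Y) ** A) = mat 1"
  proof -
    have "mat 1 + adj A ** Y = adj A ** (A + Y)"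
      by (simp add: matrix_ring_simps orth_grpD[OF assms(1)])
    then show ?thesis
      by (metis matrix_mul_assoc matrix_mul_lid matrix_inv_mult(1)[OF assms(2)] orth_grpD(2)[OF assms(1)])
  qed
  then show "invertible (mat 1 + adj A ** Y)"
    unfolding invertible_def using matrix_left_inverse_imp_right_inverse by blast
  show "cayley A Y = cayley (mat 1) (adj A ** Y) ** adj A"
    by (simp add: cayley_def matrix_inv_eqI[OF *] orth_grpD[OF assms(1)] flip: matrix_mul_assoc)
qed

lemma cayley_adj_eq:
  fixes A S :: "'k::rch_algebra^'n^'n"
  assumes "A \<in> orth_grp" "invertible (mat 1 + S)"
  shows "S ** adj A \<in> cayley_dom (adj A)" "cayley (adj A) (S ** adj A) = A ** cayley (mat 1) S"
proof -
  define R where "R = matrix_inv (mat 1 + S)"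
  have *: "(adj A + S ** adj A) ** (A ** R) = mat 1"
  proof -
    have "adj A + S ** adj A = (mat 1 + S) ** adj A"
      by (simp add: matrix_ring_simps)
    then show ?thesis
      by (metis R_def matrix_mul_assoc matrix_inv_mult(1)[OF assms(2)] orth_grpD(4)[OF assms(1)])
  qed
  then show "S ** adj A \<in> cayley_dom (adj A)"
    unfolding cayley_dom_def invertible_def using matrix_left_inverse_imp_right_inverse by blast
  show "cayley (adj A) (S ** adj A) = A ** cayley (mat 1) S"
    unfolding cayley_def matrix_inv_eqI[OF *]
    by (simp add: R_def matrix_ring_simps orth_grpD[OF assms(1)])
qed

section \<open>Derivatives of inverses and Cayley transforms along skew-Hermitian curves\<close>

lemma has_vector_derivative_iff_tendsto:
  fixes f :: "real \<Rightarrow> 'a::real_normed_vector"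
  shows "(f has_vector_derivative D) (at t) \<longleftrightarrow> ((\<lambda>s. (f s - f t) /\<^sub>R (s - t)) \<longlongrightarrow> D) (at t)"
proof -
  have "(f has_vector_derivative D) (at t) \<longleftrightarrow>
      ((\<lambda>s. norm (f s - f t - (s - t) *\<^sub>R D) / norm (s - t)) \<longlongrightarrow> 0) (at t)"
    by (simp add: has_vector_derivative_def has_derivative_iff_norm bounded_linear_scaleR_left)
  also have "\<dots> \<longleftrightarrow> ((\<lambda>s. norm ((f s - f t) /\<^sub>R (s - t) - D)) \<longlongrightarrow> 0) (at t)"
  proof (rule filterlim_cong[OF refl refl])
    show "\<forall>\<^sub>F s in at t. norm (f s - f t - (s - t) *\<^sub>R D) / norm (s - t) = norm ((f s - f t) /\<^sub>R (s - t) - D)"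
      unfolding eventually_at_filter
    proof (rule always_eventually, intro allI impI)
      fix s assume "s \<noteq> t"
      then have "f s - f t - (s - t) *\<^sub>R D = (s - t) *\<^sub>R ((f s - f t) /\<^sub>R (s - t) - D)"
        by (simp add: scaleR_diff_right)
      then show "norm (f s - f t - (s - t) *\<^sub>R D) / norm (s - t) = norm ((f s - f t) /\<^sub>R (s - t) - D)"
        using \<open>s \<noteq> t\<close> by simp
    qed
  qed
  finally show ?thesis by (simp add: tendsto_norm_zero_iff LIM_zero_iff)
qed

text \<open>The resolvent identity \<open>R s - R t = - (R s ** (S s - S t) ** R t)\<close> yields
  first the continuity of \<open>R\<close> and then, after division by \<open>s - t\<close>, its
  derivative.\<close>

lemma has_vector_derivative_inv_add_skew:
  fixes S :: "real \<Rightarrow> 'k::rch_algebra^'n^'n"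
  assumes der: "(S has_vector_derivative S') (at t)" and skew: "\<And>s. adj (S s) = - S s"
  defines "R \<equiv> \<lambda>s. matrix_inv (mat 1 + S s)"
  shows "(R has_vector_derivative - (R t ** S' ** R t)) (at t)"
proof -
  have R: "(mat 1 + S s) ** R s = mat 1" "R s ** (mat 1 + S s) = mat 1" for s
    unfolding R_def by (rule matrix_inv_mult[OF invertible_add_skew[OF skew]])+
  have diff: "R s - R t = - (R s ** (S s - S t) ** R t)" for s
  proof -
    have "R s ** (S s - S t) ** R t = (R s ** (mat 1 + S s)) ** R t - R s ** ((mat 1 + S t) ** R t)"
      by (simp add: matrix_ring_simps)
    then show ?thesis by (simp add: R)
  qed
  have "continuous (at t) S"
    using der has_vector_derivative_continuous by blast
  then have "((\<lambda>s. S s - S t) \<longlongrightarrow> 0) (at t)"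
    by (simp add: isCont_def LIM_zero_iff)
  \<comment> \<open>A factor bounded uniformly in \<open>s\<close> times one tending to 0 tends to
    0.\<close>
  moreover have "Bfun R (at t)"
    using norm_inv_add_skew[OF skew] by (auto simp: R_def intro!: BfunI always_eventually)
  ultimately have "((\<lambda>s. R s ** (S s - S t)) \<longlongrightarrow> 0) (at t)"
    unfolding tendsto_Zfun_iff by (simp add: mm.Bfun_prod_Zfun)
  then have "((\<lambda>s. R s - R t) \<longlongrightarrow> - (0 ** R t)) (at t)"
    unfolding diff by (intro tendsto_minus mm.tendsto tendsto_const)
  then have cont: "(R \<longlongrightarrow> R t) (at t)"
    by (simp add: mm.zero_left LIM_zero_iff)
  have "((\<lambda>s. - (R s ** ((S s - S t) /\<^sub>R (s - t)) ** R t)) \<longlongrightarrow> - (R t ** S' ** R t)) (at t)"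
    using der unfolding has_vector_derivative_iff_tendsto
    by (intro tendsto_minus mm.tendsto tendsto_const cont)
  moreover have "- (R s ** ((S s - S t) /\<^sub>R (s - t)) ** R t) = (R s - R t) /\<^sub>R (s - t)" for s
    unfolding diff by (simp add: mm.scaleR_left mm.scaleR_right)
  ultimately show ?thesis unfolding has_vector_derivative_iff_tendsto by simp
qed

lemma has_vector_derivative_cayley_skew:
  fixes S :: "real \<Rightarrow> 'k::rch_algebra^'n^'n"
  assumes "(S has_vector_derivative S') (at t)" and skew: "\<And>s. adj (S s) = - S s"
  defines "R \<equiv> matrix_inv (mat 1 + S t)"
  shows "((\<lambda>s. cayley (mat 1) (S s)) has_vector_derivative - (2 *\<^sub>R (R ** S' ** R))) (at t)"
proof -
  have "((\<lambda>s. 2 *\<^sub>R matrix_inv (mat 1 + S s) - mat 1) has_vector_derivative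
      2 *\<^sub>R - (R ** S' ** R) - 0) (at t)"
    unfolding R_def
    by (intro has_vector_derivative_diff has_vector_derivative_const
        bounded_linear.has_vector_derivative[OF bounded_linear_scaleR_right]
        has_vector_derivative_inv_add_skew assms)
  then show ?thesis by (simp add: cayley_mat_1[OF invertible_add_skew[OF skew]])
qed

section \<open>The identity component\<close>

lemma G_grp_subset: "G_grp \<subseteq> orth_grp"
  unfolding G_grp_def by (rule connected_component_subset)

lemma mat_1_in_G_grp: "mat 1 \<in> G_grp"
  unfolding G_grp_def by (simp add: mat_1_in_orth_grp)

lemma connected_G_grp: "connected G_grp"
  unfolding G_grp_def by simp

lemma connected_subset_G_grp:
  "connected T \<Longrightarrow> T \<subseteq> orth_grp \<Longrightarrow> B \<in> T \<Longrightarrow> B \<in> G_grp \<Longrightarrow> T \<subseteq> G_grp"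
  unfolding G_grp_def by (metis connected_component_eq connected_component_maximal)

text \<open>Left translation by \<open>A\<close> turns the component into a connected set of unitary
  matrices containing \<open>A\<close>.\<close>

lemma G_grp_mult:
  assumes "A \<in> G_grp" "B \<in> G_grp"
  shows "A ** B \<in> G_grp"
proof -
  have "connected ((**) A ` G_grp)"
    by (intro connected_continuous_image connected_G_grp linear_continuous_on mm.bounded_linear_right)
  moreover have "(**) A ` G_grp \<subseteq> orth_grp"
    using assms G_grp_subset orth_grp_mult by fast
  moreover have "A \<in> (**) A ` G_grp"
    using mat_1_in_G_grp by (metis image_eqI matrix_mul_rid)
  ultimately show ?thesis using connected_subset_G_grp assms by blast
qed

lemma G_grp_adj:
  assumes "A \<in> G_grp"
  shows "adj A \<in> G_grp"
proof -
  have "connected (adj ` G_grp)"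
    by (intro connected_continuous_image connected_G_grp linear_continuous_on bounded_linear_adj)
  moreover have "adj ` G_grp \<subseteq> orth_grp"
    using G_grp_subset orth_grp_adj by fast
  moreover have "mat 1 \<in> adj ` G_grp"
    using mat_1_in_G_grp by (metis image_eqI adj_mat_1)
  ultimately show ?thesis using connected_subset_G_grp mat_1_in_G_grp assms by blast
qed

lemma norm_orth_grp:
  fixes A :: "'k::rch_algebra^'n^'n"
  assumes "A \<in> orth_grp"
  shows "norm A = norm (mat 1 :: 'k^'n^'n)"
  using norm_orth_grp_mult(1)[OF assms, of "mat 1"] by simp

text \<open>Makes the model compact, hence closed, so that distance zero from it means
  membership.\<close>

lemma compact_G_grp: "compact (G_grp :: ('k::rch_algebra^'n^'n) set)"
proof -
  have "closed (orth_grp :: ('k^'n^'n) set)"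
    unfolding orth_grp_def
    by (intro closed_Collect_eq mm.continuous_on linear_continuous_on bounded_linear_adj continuous_on_id continuous_on_const)
  then have "closed (G_grp :: ('k^'n^'n) set)"
    unfolding G_grp_def by (rule closed_connected_component)
  moreover have "bounded (G_grp :: ('k^'n^'n) set)"
    unfolding bounded_iff using norm_orth_grp G_grp_subset by (metis order_refl subsetD)
  ultimately show ?thesis by (simp add: compact_eq_bounded_closed)
qed

lemma cayley_mat_1_0: "cayley (mat 1) 0 = mat 1"
proof -
  have "matrix_inv (mat 1 + 0 :: 'k::rch_algebra^'n^'n) = mat 1" by (rule matrix_inv_eqI) simp
  then show ?thesis by (simp add: cayley_def mm.zero_right)
qed

lemma has_vector_derivative_cayley_line:
  fixes S :: "'k::rch_algebra^'n^'n"
  assumes "adj S = - S"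
  shows "((\<lambda>h. cayley (mat 1) (h *\<^sub>R S)) has_vector_derivative
    - (2 *\<^sub>R (matrix_inv (mat 1 + h *\<^sub>R S) ** S ** matrix_inv (mat 1 + h *\<^sub>R S)))) (at h)"
proof (rule has_vector_derivative_cayley_skew)
  have "((\<lambda>h. h *\<^sub>R S) has_vector_derivative 1 *\<^sub>R S) (at h)"
    by (rule bounded_linear.has_vector_derivative[OF bounded_linear_scaleR_left has_vector_derivative_id])
  then show "((\<lambda>h. h *\<^sub>R S) has_vector_derivative S) (at h)" by simp
qed (simp add: adj_scaleR assms)

text \<open>The Cayley image of the real line through \<open>S\<close> joins this matrix to
  \<open>mat 1\<close> within the unitary matrices.\<close>

lemma cayley_mat_1_in_G_grp:
  fixes S :: "'k::rch_algebra^'n^'n"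
  assumes "adj S = - S"
  shows "cayley (mat 1) S \<in> G_grp"
proof -
  let ?c = "\<lambda>h::real. cayley (mat 1) (h *\<^sub>R S)"
  have "continuous_on UNIV ?c"
    using has_vector_derivative_cayley_line[OF assms] has_vector_derivative_continuous
    by (blast intro: continuous_at_imp_continuous_on)
  then have "connected (range ?c)" by (rule connected_continuous_image) simp
  moreover have "range ?c \<subseteq> orth_grp"
    by (auto intro!: cayley_mat_1_orth simp: adj_scaleR assms)
  moreover have "mat 1 \<in> range ?c"
    by (rule range_eqI[of _ _ 0]) (simp add: cayley_mat_1_0)
  ultimately have "range ?c \<subseteq> G_grp"
    using connected_subset_G_grp mat_1_in_G_grp by blast
  moreover have "cayley (mat 1) S = ?c 1" by simp
  ultimately show ?thesis by blast
qed

section \<open>The Cartan model\<close>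

locale cartan =
  fixes \<sigma> :: "'k::rch_algebra^'n^'n \<Rightarrow> 'k^'n^'n"
  assumes cartan_involution: "cartan_involution \<sigma>"
begin

lemma linear: "linear \<sigma>"
  and one: "\<sigma> (mat 1) = mat 1"
  and mult: "\<sigma> (Y ** Z) = \<sigma> Y ** \<sigma> Z"
  and invol: "\<sigma> (\<sigma> Y) = Y"
  and adj: "\<sigma> (adj Y) = adj (\<sigma> Y)"
  and image_G_grp: "\<sigma> ` G_grp = G_grp"
  using cartan_involution by (simp_all add: cartan_involution_def)

lemma bounded_linear: "bounded_linear \<sigma>"
  using linear linear_conv_bounded_linear by blast

lemmas hom_simps = mult adj invol one linear_add[OF linear] linear_diff[OF linear]
  linear_cmul[OF linear] linear_neg[OF linear]

lemma G_grp: "C \<in> G_grp \<Longrightarrow> \<sigma> C \<in> G_grp"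
  using image_G_grp by blast

lemma re_tr: "re_tr (\<sigma> Y) = re_tr Y"
proof (rule re_tr_unique[where \<phi> = "\<lambda>Y. re_tr (\<sigma> Y)"])
  show "linear (\<lambda>Y. re_tr (\<sigma> Y))"
    using linear_compose[OF linear linear_re_tr] by (simp add: o_def)
  show "re_tr (\<sigma> (A ** B)) = re_tr (\<sigma> (B ** A))" for A B
    unfolding mult by (rule re_tr_mult_commute)
  show "re_tr (\<sigma> (adj A)) = re_tr (\<sigma> A)" for A
    by (simp add: adj re_tr_adj)
  show "re_tr (\<sigma> (mat 1)) = CARD('n)"
    unfolding one by (simp add: kRe_of_nat re_tr_def trace_def linear_sum[OF linear_kRe] mat_def)
qed

lemma cartan_model_eq: "cartan_model \<sigma> = (\<lambda>C. C ** adj (\<sigma> C)) ` G_grp"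
proof -
  have "matrix_inv (\<sigma> C) = adj (\<sigma> C)" if "C \<in> G_grp" for C
    using G_grp[OF that] G_grp_subset orth_grpD(1) by (intro matrix_inv_eqI) blast
  then show ?thesis unfolding cartan_model_def by force
qed

lemma cartan_modelD:
  assumes "B \<in> cartan_model \<sigma>"
  shows "B \<in> orth_grp" "\<sigma> B = adj B"
proof -
  obtain C where C: "C \<in> G_grp" "B = C ** adj (\<sigma> C)"
    using assms by (auto simp: cartan_model_eq)
  then have "C \<in> orth_grp" "\<sigma> C \<in> orth_grp"
    using G_grp G_grp_subset by blast+
  then show "B \<in> orth_grp" unfolding C(2) by (intro orth_grp_mult orth_grp_adj)
  show "\<sigma> B = adj B" by (simp add: C(2) hom_simps adj_mult)
qed

text \<open>Left translation on the homogeneous space, transported to the model.\<close>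

lemma cartan_model_act:
  assumes "C \<in> G_grp" "B \<in> cartan_model \<sigma>"
  shows "C ** B ** adj (\<sigma> C) \<in> cartan_model \<sigma>"
proof -
  obtain D where D: "D \<in> G_grp" "B = D ** adj (\<sigma> D)"
    using assms(2) by (auto simp: cartan_model_eq)
  then have "C ** B ** adj (\<sigma> C) = (C ** D) ** adj (\<sigma> (C ** D))"
    by (simp add: hom_simps matrix_ring_simps)
  then show ?thesis
    unfolding cartan_model_eq using G_grp_mult[OF assms(1) D(1)] by blast
qed

lemma cartan_model_act_image:
  assumes "C \<in> G_grp"
  shows "(\<lambda>B. C ** B ** adj (\<sigma> C)) ` cartan_model \<sigma> = cartan_model \<sigma>" (is "?f ` _ = _")
proof
  show "?f ` cartan_model \<sigma> \<subseteq> cartan_model \<sigma>"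
    using cartan_model_act[OF assms] by blast
  show "cartan_model \<sigma> \<subseteq> ?f ` cartan_model \<sigma>"
  proof
    fix B assume B: "B \<in> cartan_model \<sigma>"
    have C: "C \<in> orth_grp" "\<sigma> C \<in> orth_grp"
      using assms G_grp G_grp_subset by blast+
    have "?f (adj C ** B ** \<sigma> C) = B"
      by (simp add: matrix_ring_simps orth_grpD[OF C(1)] orth_grpD[OF C(2)])
    moreover have "adj C ** B ** \<sigma> C \<in> cartan_model \<sigma>"
      using cartan_model_act[OF G_grp_adj[OF assms] B] by (simp add: adj)
    ultimately show "B \<in> ?f ` cartan_model \<sigma>" by force
  qed
qed

lemma compact_cartan_model: "compact (cartan_model \<sigma>)"
  unfolding cartan_model_eq
  by (intro compact_continuous_image compact_G_grp mm.continuous_on continuous_on_id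
      bounded_linear.continuous_on[OF bounded_linear_adj] linear_continuous_on bounded_linear)

lemma cartan_model_nonempty: "cartan_model \<sigma> \<noteq> {}"
  using mat_1_in_G_grp by (auto simp: cartan_model_eq)

text \<open>The action multiplies by a unitary matrix on either side, so it is isometric, and it
  maps the model onto itself.\<close>

lemma infdist_act:
  assumes "C \<in> G_grp"
  shows "infdist (C ** B ** adj (\<sigma> C)) (cartan_model \<sigma>) = infdist B (cartan_model \<sigma>)"
proof -
  have C: "C \<in> orth_grp" "adj (\<sigma> C) \<in> orth_grp"
    using assms G_grp G_grp_subset orth_grp_adj by blast+
  have "dist (C ** B ** adj (\<sigma> C)) (C ** D ** adj (\<sigma> C)) = dist B D" for D
    by (simp add: dist_norm norm_orth_grp_mult C flip: mm.diff_left mm.diff_right)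
  then have "infdist (C ** B ** adj (\<sigma> C)) ((\<lambda>B. C ** B ** adj (\<sigma> C)) ` cartan_model \<sigma>)
      = infdist B (cartan_model \<sigma>)"
    by (simp add: infdist_def cartan_model_nonempty image_image)
  then show ?thesis by (simp only: cartan_model_act_image[OF assms])
qed

text \<open>To first order the curve moves by the isometric action of \<open>G_grp\<close> on the model, so its
  distance to the model has derivative zero. This avoids charts of the model.\<close>

lemma curve_in_cartan_model:
  assumes orth: "\<And>t. \<alpha> t \<in> orth_grp" and sym: "\<And>t. \<sigma> (\<alpha> t) = adj (\<alpha> t)"
    and der: "\<And>t. (\<alpha> has_vector_derivative \<alpha>' t) (at t)"
    and start: "\<alpha> t0 \<in> cartan_model \<sigma>"
  shows "\<alpha> t \<in> cartan_model \<sigma>"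
proof -
  define d where "d s = infdist (\<alpha> s) (cartan_model \<sigma>)" for s
  have "(d has_real_derivative 0) (at s)" for s
  proof -
    note A = orth_grpD[OF orth[of s]]
    \<comment> \<open>The velocity written as \<open>W ** \<alpha> s\<close>. Differentiating
      unitarity makes \<open>W\<close> skew-Hermitian; differentiating the other condition also
      gives \<open>\<alpha> s ** adj (\<sigma> W)\<close> as the velocity.\<close>
    define W where "W = \<alpha>' s ** adj (\<alpha> s)"
    have "((\<lambda>s. \<alpha> s ** adj (\<alpha> s)) has_vector_derivative
        \<alpha> s ** adj (\<alpha>' s) + \<alpha>' s ** adj (\<alpha> s)) (at s)"
      by (intro mm.has_vector_derivative der bounded_linear.has_vector_derivative[OF bounded_linear_adj])
    then have "((\<lambda>s. mat 1 :: 'k^'n^'n) has_vector_derivative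
        \<alpha> s ** adj (\<alpha>' s) + \<alpha>' s ** adj (\<alpha> s)) (at s)"
      by (simp add: orth_grpD[OF orth])
    then have skew: "adj W = - W"
      using vector_derivative_unique_at[OF _ has_vector_derivative_const]
      by (fastforce simp: W_def adj_mult eq_neg_iff_add_eq_0)
    have "\<sigma> (\<alpha>' s) = adj (\<alpha>' s)"
    proof (rule vector_derivative_unique_at)
      show "((\<lambda>s. \<sigma> (\<alpha> s)) has_vector_derivative \<sigma> (\<alpha>' s)) (at s)"
        by (rule bounded_linear.has_vector_derivative[OF bounded_linear der])
      show "((\<lambda>s. \<sigma> (\<alpha> s)) has_vector_derivative adj (\<alpha>' s)) (at s)"
        unfolding sym by (rule bounded_linear.has_vector_derivative[OF bounded_linear_adj der])
    qed
    then have W: "W ** \<alpha> s = \<alpha>' s" "\<alpha> s ** adj (\<sigma> W) = \<alpha>' s"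
      by (simp_all add: W_def hom_simps sym matrix_ring_simps A)
    \<comment> \<open>The left and the right factor of the action each contribute half of the
      velocity, so \<open>C\<close> must have derivative \<open>W / 2\<close> at 0. The Cayley
      transform has derivative -2 times its argument there, whence -1/4.\<close>
    define C where "C h = cayley (mat 1) (h *\<^sub>R (- (1 / 4) *\<^sub>R W))" for h
    have "adj (- (1 / 4) *\<^sub>R W) = - (- (1 / 4) *\<^sub>R W)"
      by (simp add: matrix_ring_simps skew)
    note C_der = has_vector_derivative_cayley_line[OF this, of 0, folded C_def]
    have "matrix_inv (mat 1 :: 'k^'n^'n) = mat 1" by (rule matrix_inv_eqI) simp
    then have C_der: "(C has_vector_derivative (1 / 2) *\<^sub>R W) (at 0)"
      using C_der by (simp add: mm.minus_left mm.minus_right mm.scaleR_left C_def[abs_def])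
    have C0: "C 0 = mat 1" by (simp add: C_def cayley_mat_1_0)
    have CG: "C h \<in> G_grp" for h
      unfolding C_def by (rule cayley_mat_1_in_G_grp) (simp add: matrix_ring_simps skew)
    define P where "P h = C h ** \<alpha> s ** adj (\<sigma> (C h))" for h
    have "(P has_vector_derivative
        (C 0 ** \<alpha> s) ** adj (\<sigma> ((1 / 2) *\<^sub>R W)) + ((C 0 ** 0 + (1 / 2) *\<^sub>R W ** \<alpha> s)) ** adj (\<sigma> (C 0))) (at 0)"
      unfolding P_def
      by (intro mm.has_vector_derivative C_der has_vector_derivative_const
          bounded_linear.has_vector_derivative[OF bounded_linear_adj]
          bounded_linear.has_vector_derivative[OF bounded_linear])
    moreover have "(1 / 2) *\<^sub>R \<alpha>' s + (1 / 2) *\<^sub>R \<alpha>' s = \<alpha>' s"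
      by (simp flip: scaleR_add_left)
    ultimately have P_der: "(P has_vector_derivative \<alpha>' s) (at 0)"
      by (simp add: C0 hom_simps matrix_ring_simps W)
    have P0: "P 0 = \<alpha> s" by (simp add: P_def C0 one)
    have "((\<lambda>h. s + h) has_vector_derivative 1) (at 0)"
      by (auto intro!: derivative_eq_intros)
    then have "((\<lambda>h. \<alpha> (s + h)) has_vector_derivative 1 *\<^sub>R \<alpha>' s) (at 0)"
      using vector_diff_chain_at[of "\<lambda>h. s + h" 1 0 \<alpha> "\<alpha>' s"] der[of s] by (simp add: o_def)
    then have "((\<lambda>h. \<alpha> (s + h) - P h) has_vector_derivative 0) (at 0)"
      using has_vector_derivative_diff[OF _ P_der] by fastforce
    then have lim: "((\<lambda>h. (\<alpha> (s + h) - P h) /\<^sub>R h) \<longlongrightarrow> 0) (at 0)"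
      by (simp add: has_vector_derivative_iff_tendsto P0)
    \<comment> \<open>\<open>P h\<close> is as far from the model as \<open>\<alpha> s\<close>, and
      the distance function is 1-Lipschitz. The curves agree to first order, so the quotient tends
      to 0.\<close>
    have "norm ((d (s + h) - d s) / h) \<le> norm ((\<alpha> (s + h) - P h) /\<^sub>R h)" for h
    proof -
      have "d s = infdist (P h) (cartan_model \<sigma>)"
        by (simp add: d_def P_def infdist_act[OF CG])
      then have "\<bar>d (s + h) - d s\<bar> \<le> norm (\<alpha> (s + h) - P h)"
        using infdist_triangle_abs[of "\<alpha> (s + h)" "cartan_model \<sigma>" "P h"]
        by (simp add: d_def dist_norm)
      then show ?thesis by (simp add: divide_inverse mult.commute[of "inverse \<bar>h\<bar>"] abs_mult mult_right_mono)
    qed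
    then have "((\<lambda>h. (d (s + h) - d s) / h) \<longlongrightarrow> 0) (at 0)"
      by (intro Lim_null_comparison[OF _ tendsto_norm_zero[OF lim]] always_eventually allI)
    then show ?thesis by (simp add: DERIV_def)
  qed
  then have "d t = d t0" by (rule DERIV_isconst_all[rule_format, rotated]) 
  also have "d t0 = 0" using start by (simp add: d_def)
  finally show ?thesis
    unfolding d_def
    using in_closed_iff_infdist_zero[OF compact_imp_closed[OF compact_cartan_model] cartan_model_nonempty]
    by blast
qed

section \<open>The gradient and the critical points of the height function\<close>

lemma gradient_in_cartan_tangent:
  assumes B: "B \<in> orth_grp" "\<sigma> B = adj B" and Xh: "Xh = adj X + \<sigma> X"
  shows "(1 / 4) *\<^sub>R (Xh - B ** \<sigma> Xh ** B) \<in> cartan_tangent \<sigma> B"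
  by (simp add: cartan_tangent_def Xh hom_simps B(2) matrix_ring_simps orth_grpD[OF B(1)]
      algebra_simps flip: scaleR_add_right)

text \<open>\<open>Xh\<close> pairs with \<open>Y\<close> to twice the height: the half
  \<open>\<sigma> X\<close> is turned into the other one by applying \<open>\<sigma>\<close> and
  \<open>adj\<close> under the trace. The quadratic term pairs to minus the same value by the first
  tangency equation, so the difference is four times the height.\<close>

lemma height_eq_inner_gradient:
  assumes B: "B \<in> orth_grp" "\<sigma> B = adj B" and Xh: "Xh = adj X + \<sigma> X"
    and Y: "Y \<in> cartan_tangent \<sigma> B"
  shows "height X Y = re_tr (adj ((1 / 4) *\<^sub>R (Xh - B ** \<sigma> Xh ** B)) ** Y)"
proof -
  have YT: "Y ** adj B + B ** adj Y = 0" "\<sigma> Y = adj Y"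
    using Y by (auto simp: cartan_tangent_def)
  have \<sigma>X: "\<sigma> Xh = adj Xh" by (simp add: Xh hom_simps matrix_ring_simps)
  have 1: "re_tr (adj Xh ** Y) = 2 * height X Y"
  proof -
    have "re_tr (\<sigma> (adj X) ** Y) = re_tr (\<sigma> (\<sigma> (adj X) ** Y))" by (simp only: re_tr)
    also have "\<dots> = re_tr (adj (Y ** X))" by (simp only: mult invol YT adj_mult)
    also have "\<dots> = height X Y" unfolding height_def re_tr_adj by (rule re_tr_mult_commute)
    finally show ?thesis
      by (simp add: Xh matrix_ring_simps re_tr_linear_simps hom_simps height_def)
  qed
  have "re_tr (adj (B ** \<sigma> Xh ** B) ** Y) = re_tr (adj B ** (Xh ** (adj B ** Y)))"
    by (simp add: \<sigma>X matrix_ring_simps)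
  also have "\<dots> = re_tr (Xh ** (adj B ** (Y ** adj B)))"
    by (subst re_tr_mult_commute) (simp add: matrix_ring_simps)
  also have "Y ** adj B = - (B ** adj Y)" using YT(1) by (simp add: eq_neg_iff_add_eq_0)
  also have "re_tr (Xh ** (adj B ** - (B ** adj Y))) = - re_tr (adj (Y ** adj Xh))"
    by (simp add: matrix_ring_simps orth_grpD[OF B(1)] re_tr_linear_simps)
  also have "\<dots> = - re_tr (adj Xh ** Y)"
    unfolding re_tr_adj by (subst re_tr_mult_commute) simp
  finally have 2: "re_tr (adj (B ** \<sigma> Xh ** B) ** Y) = - re_tr (adj Xh ** Y)" .
  show ?thesis
    unfolding adj_scaleR adj_diff mm.scaleR_left mm.diff_left re_tr_linear_simps 2 1 by simp
qed

lemma height_has_derivative: "(height X has_derivative height X) (at B)"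
proof -
  have "linear (height X)"
    using linear_compose[OF linear_mult_left linear_re_tr] by (simp add: height_def[abs_def] o_def)
  then show ?thesis
    using linear_conv_bounded_linear bounded_linear_imp_has_derivative by blast
qed

lemma cartan_gradient_height:
  assumes "B \<in> cartan_model \<sigma>" "Xh = adj X + \<sigma> X"
  shows "cartan_gradient \<sigma> (height X) B ((1 / 4) *\<^sub>R (Xh - B ** \<sigma> Xh ** B))"
  unfolding cartan_gradient_def
  using gradient_in_cartan_tangent height_eq_inner_gradient height_has_derivative
    cartan_modelD[OF assms(1)] assms(2) by blast

text \<open>The gradient is itself a tangent direction, and the derivative along it is its squared
  norm.\<close>

lemma cartan_critical_height:
  assumes crit: "cartan_critical \<sigma> (height X) A" and Xh: "Xh = adj X + \<sigma> X"
  shows "A ** \<sigma> Xh ** A = Xh"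
proof -
  obtain D where D: "(height X has_derivative D) (at A)" "\<And>Y. Y \<in> cartan_tangent \<sigma> A \<Longrightarrow> D Y = 0"
    and A: "A \<in> cartan_model \<sigma>"
    using crit by (auto simp: cartan_critical_def)
  define V where "V = (1 / 4) *\<^sub>R (Xh - A ** \<sigma> Xh ** A)"
  note AN = cartan_modelD[OF A]
  have V: "V \<in> cartan_tangent \<sigma> A"
    unfolding V_def by (rule gradient_in_cartan_tangent[OF AN Xh])
  have "D = height X" by (rule has_derivative_unique[OF D(1) height_has_derivative])
  then have "(norm V)\<^sup>2 = 0"
    using height_eq_inner_gradient[OF AN Xh V] D(2)[OF V]
    by (simp add: norm_matrix_squared flip: V_def)
  then show ?thesis by (simp add: V_def)
qed

end

section \<open>Uniqueness of solutions\<close>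

text \<open>The squared norm of \<open>\<delta>\<close> times \<open>exp (- 2 * L * s)\<close>
  decreases and times \<open>exp (2 * L * s)\<close> increases, so a zero propagates both forward
  and backward in time.\<close>

lemma has_vector_derivative_gronwall_zero:
  fixes \<delta> :: "real \<Rightarrow> 'a::real_inner"
  assumes ab: "a \<le> b"
    and der: "\<And>s. s \<in> {a..b} \<Longrightarrow> (\<delta> has_vector_derivative \<delta>' s) (at s within {a..b})"
    and bound: "\<And>s. s \<in> {a..b} \<Longrightarrow> norm (\<delta>' s) \<le> L * norm (\<delta> s)"
  shows "\<delta> a = 0 \<longleftrightarrow> \<delta> b = 0"
proof -
  define \<phi> where "\<phi> c s = exp (c * s) * (\<delta> s \<bullet> \<delta> s)" for c s
  have der_\<phi>: "(\<phi> c has_real_derivative exp (c * s) * (c * (\<delta> s \<bullet> \<delta> s) + 2 * (\<delta> s \<bullet> \<delta>' s)))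
      (at s within {a..b})" if "s \<in> {a..b}" for c s
  proof -
    have "((\<lambda>s. \<delta> s \<bullet> \<delta> s) has_vector_derivative \<delta> s \<bullet> \<delta>' s + \<delta>' s \<bullet> \<delta> s) (at s within {a..b})"
      by (rule bounded_bilinear.has_vector_derivative[OF bounded_bilinear_inner der[OF that] der[OF that]])
    then have "((\<lambda>s. \<delta> s \<bullet> \<delta> s) has_real_derivative 2 * (\<delta> s \<bullet> \<delta>' s)) (at s within {a..b})"
      by (simp add: has_real_derivative_iff_has_vector_derivative inner_commute)
    then show ?thesis
      unfolding \<phi>_def by (auto intro!: derivative_eq_intros simp: algebra_simps)
  qed
  have cont: "continuous_on {a..b} (\<phi> c)" for c
    using der_\<phi> by (rule DERIV_continuous_on)
  have der_in: "(\<phi> c has_real_derivative exp (c * s) * (c * (\<delta> s \<bullet> \<delta> s) + 2 * (\<delta> s \<bullet> \<delta>' s))) (at s)"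
    if "a < s" "s < b" for c s
    using der_\<phi>[of s c] that by (simp add: at_within_Icc_at)
  have est: "\<bar>2 * (\<delta> s \<bullet> \<delta>' s)\<bar> \<le> 2 * L * (\<delta> s \<bullet> \<delta> s)" if "a < s" "s < b" for s
  proof -
    have "\<bar>\<delta> s \<bullet> \<delta>' s\<bar> \<le> norm (\<delta> s) * norm (\<delta>' s)" by (rule Cauchy_Schwarz_ineq2)
    also have "\<dots> \<le> norm (\<delta> s) * (L * norm (\<delta> s))"
      using bound[of s] that by (intro mult_left_mono) auto
    also have "\<dots> = L * (\<delta> s \<bullet> \<delta> s)"
      by (simp add: power2_norm_eq_inner[symmetric] power2_eq_square)
    finally show ?thesis by simp
  qed
  have "\<phi> (- 2 * L) b \<le> \<phi> (- 2 * L) a"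
  proof (rule DERIV_nonpos_imp_decreasing_open[OF ab _ cont])
    fix s assume s: "a < s" "s < b"
    show "\<exists>y. (\<phi> (- 2 * L) has_real_derivative y) (at s) \<and> y \<le> 0"
    proof (intro exI conjI)
      show "exp (- 2 * L * s) * (- 2 * L * (\<delta> s \<bullet> \<delta> s) + 2 * (\<delta> s \<bullet> \<delta>' s)) \<le> 0"
        using est[OF s] by (intro mult_nonneg_nonpos) auto
    qed (rule der_in[OF s])
  qed
  moreover have "\<phi> (2 * L) a \<le> \<phi> (2 * L) b"
  proof (rule DERIV_nonneg_imp_increasing_open[OF ab _ cont])
    fix s assume s: "a < s" "s < b"
    show "\<exists>y. (\<phi> (2 * L) has_real_derivative y) (at s) \<and> 0 \<le> y"
    proof (intro exI conjI)
      show "0 \<le> exp (2 * L * s) * (2 * L * (\<delta> s \<bullet> \<delta> s) + 2 * (\<delta> s \<bullet> \<delta>' s))"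
        using est[OF s] by (intro mult_nonneg_nonneg) auto
    qed (rule der_in[OF s])
  qed
  moreover have "\<phi> c s \<ge> 0" "\<phi> c s = 0 \<longleftrightarrow> \<delta> s = 0" for c s
    by (simp_all add: \<phi>_def)
  ultimately show ?thesis by (metis antisym)
qed

text \<open>The field is quadratic, hence Lipschitz on bounded sets, and both solutions are bounded
  on the compact interval between the two times.\<close>

lemma solves_gradient_eq_unique:
  fixes \<sigma> :: "'k::rch_algebra^'n^'n \<Rightarrow> 'k^'n^'n"
  assumes sol: "solves_gradient_eq \<sigma> Xh J \<alpha>" "solves_gradient_eq \<sigma> Xh J \<gamma>"
    and J: "is_interval J" "s \<in> J" "t \<in> J" and eq: "\<gamma> s = \<alpha> s"
  shows "\<gamma> t = \<alpha> t"
proof -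
  define Z where "Z = \<sigma> Xh"
  have zero: "\<gamma> a - \<alpha> a = 0 \<longleftrightarrow> \<gamma> b - \<alpha> b = 0" if ab: "a \<le> b" "a \<in> J" "b \<in> J" for a b
  proof -
    have sub: "{a..b} \<subseteq> J" using J(1) ab(2,3) unfolding is_interval_1 by (meson atLeastAtMost_iff subsetI)
    define F where "F Y = (1 / 4) *\<^sub>R (Xh - Y ** Z ** Y)" for Y
    have F: "(f has_vector_derivative F (f u)) (at u within {a..b})"
      if f: "solves_gradient_eq \<sigma> Xh J f" and u: "u \<in> {a..b}" for f u
    proof -
      obtain f' where f': "(f has_vector_derivative f') (at u within J)" "4 *\<^sub>R f' = Xh - f u ** Z ** f u"
        using f u sub unfolding solves_gradient_eq_def Z_def by blast
      have "f' = (1 / 4) *\<^sub>R (4 *\<^sub>R f')" by simp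
      then have "f' = F (f u)" unfolding F_def f'(2) .
      then show ?thesis using has_vector_derivative_within_subset[OF f'(1) sub] by simp
    qed
    have cont: "continuous_on {a..b} f" if "solves_gradient_eq \<sigma> Xh J f" for f
      using F[OF that] has_vector_derivative_continuous continuous_on_eq_continuous_within by blast
    have bdd: "\<exists>c\<ge>0. \<forall>u\<in>{a..b}. norm (f u) \<le> c" if "solves_gradient_eq \<sigma> Xh J f" for f
    proof -
      have "bounded (f ` {a..b})"
        by (intro compact_imp_bounded compact_continuous_image cont that) simp
      then show ?thesis by (metis bounded_pos image_eqI less_imp_le)
    qed
    obtain c1 where c1: "c1 \<ge> 0" "\<And>u. u \<in> {a..b} \<Longrightarrow> norm (\<alpha> u) \<le> c1" using bdd[OF sol(1)] by blast
    obtain c2 where c2: "c2 \<ge> 0" "\<And>u. u \<in> {a..b} \<Longrightarrow> norm (\<gamma> u) \<le> c2" using bdd[OF sol(2)] by blast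
    obtain K where K: "K \<ge> 0" "\<And>(Y :: 'k^'n^'n) (W :: 'k^'n^'n). norm (Y ** W) \<le> norm Y * norm W * K"
      using mm.nonneg_bounded by blast
    have K3: "norm (Y ** Z ** W) \<le> norm Y * norm W * (norm Z * K * K)" for Y W :: "'k^'n^'n"
    proof -
      have "norm (Y ** Z ** W) \<le> norm (Y ** Z) * norm W * K" by (rule K)
      also have "\<dots> \<le> (norm Y * norm Z * K) * norm W * K"
        using K by (intro mult_right_mono) auto
      finally show ?thesis by (simp add: mult_ac)
    qed
    define L where "L = (c2 + c1) * (norm Z * K * K)"
    show ?thesis
    proof (rule has_vector_derivative_gronwall_zero[OF ab(1), where \<delta> = "\<lambda>u. \<gamma> u - \<alpha> u" and L = L])
      fix u assume u: "u \<in> {a..b}"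
      show "((\<lambda>u. \<gamma> u - \<alpha> u) has_vector_derivative F (\<gamma> u) - F (\<alpha> u)) (at u within {a..b})"
        by (intro has_vector_derivative_diff F sol u)
      \<comment> \<open>The difference of two quadratic terms telescopes through the mixed product
        \<open>\<gamma> u ** Z ** \<alpha> u\<close>.\<close>
      have "F (\<gamma> u) - F (\<alpha> u) = - ((1 / 4) *\<^sub>R (\<gamma> u ** Z ** (\<gamma> u - \<alpha> u) + (\<gamma> u - \<alpha> u) ** Z ** \<alpha> u))"
        by (simp add: F_def matrix_ring_simps flip: scaleR_diff_right scaleR_minus_right)
      then have "norm (F (\<gamma> u) - F (\<alpha> u)) \<le> norm (\<gamma> u ** Z ** (\<gamma> u - \<alpha> u) + (\<gamma> u - \<alpha> u) ** Z ** \<alpha> u)"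
        by simp
      also have "\<dots> \<le> norm (\<gamma> u ** Z ** (\<gamma> u - \<alpha> u)) + norm ((\<gamma> u - \<alpha> u) ** Z ** \<alpha> u)"
        by (rule norm_triangle_ineq)
      also have "\<dots> \<le> (norm (\<gamma> u) + norm (\<alpha> u)) * (norm Z * K * K) * norm (\<gamma> u - \<alpha> u)"
        using K3[of "\<gamma> u" "\<gamma> u - \<alpha> u"] K3[of "\<gamma> u - \<alpha> u" "\<alpha> u"] by (simp add: algebra_simps)
      also have "\<dots> \<le> L * norm (\<gamma> u - \<alpha> u)"
        unfolding L_def using c1(2)[OF u] c2(2)[OF u] K(1) by (intro mult_right_mono add_mono) auto
      finally show "norm (F (\<gamma> u) - F (\<alpha> u)) \<le> L * norm (\<gamma> u - \<alpha> u)" .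
    qed
  qed
  show ?thesis
    using zero[of s t] zero[of t s] J(2,3) eq by (cases "s \<le> t") auto
qed

section \<open>The flow in the Cayley chart\<close>

context cartan
begin

lemma explicit_solution:
  assumes A: "A \<in> orth_grp" "\<sigma> A = adj A"
    and \<alpha>0: "\<alpha>0 \<in> cartan_model \<sigma>" "invertible (A + \<alpha>0)"
    and Xh: "\<sigma> Xh = adj Xh" "A ** \<sigma> Xh ** A = Xh"
  defines "\<beta>0 \<equiv> cayley A \<alpha>0"
  defines "\<beta> \<equiv> \<lambda>t. mat_exp (- (t / 4) *\<^sub>R (adj A ** Xh)) ** \<beta>0 ** mat_exp (- (t / 4) *\<^sub>R (Xh ** adj A))"
  defines "\<alpha> \<equiv> \<lambda>t. cayley (adj A) (\<beta> t)"
  shows "\<beta>0 \<in> cartan_tangent \<sigma> (adj A)" "\<beta> t \<in> cayley_dom (adj A)" "\<alpha> t \<in> cartan_model \<sigma>"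
    "\<alpha> 0 = \<alpha>0" "solves_gradient_eq \<sigma> Xh UNIV \<alpha>"
proof -
  note AA = orth_grpD[OF A(1)]
  note \<alpha>0N = cartan_modelD[OF \<alpha>0(1)]
  define H where "H = adj A ** Xh"
  define U where "U = adj A ** \<alpha>0"
  define S0 where "S0 = cayley (mat 1) U"
  define E where "E t = mat_exp (- (t / 4) *\<^sub>R H)" for t
  define S where "S t = E t ** S0 ** E t" for t
  define C where "C t = cayley (mat 1) (S t)" for t

  have XhH: "Xh = A ** H" by (simp add: H_def AA)
  \<comment> \<open>Cancelling \<open>A\<close> in the critical point equation leaves
    \<open>adj Xh ** A\<close>, which is the adjoint of \<open>H\<close>.\<close>
  have "H = adj A ** (A ** \<sigma> Xh ** A)" by (simp add: H_def Xh(2))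
  then have H2: "adj Xh ** A = H" by (simp add: AA Xh(1) matrix_mul_assoc[symmetric])
  have H_adj: "adj H = H" using H2 by (simp add: H_def adj_mult)
  have U: "U \<in> orth_grp" unfolding U_def by (intro orth_grp_mult orth_grp_adj A \<alpha>0N)
  have U_inv: "invertible (mat 1 + U)" and \<beta>0: "\<beta>0 = S0 ** adj A"
    using cayley_orth_eq[OF A(1) \<alpha>0(2)] by (simp_all add: U_def S0_def \<beta>0_def)
  have S0_skew: "adj S0 = - S0"
    unfolding S0_def by (rule cayley_mat_1_skew[OF U U_inv])
  have E_adj: "adj (E t) = E t" for t
    unfolding E_def
    by (subst mat_exp_antihom[of adj]) (simp_all add: linear_adj matrix_ring_simps H_adj)
  have skew: "adj (S t) = - S t" for t
    by (simp add: S_def matrix_ring_simps E_adj S0_skew)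
  note S_inv = invertible_add_skew[OF skew]
  have \<beta>: "\<beta> t = S t ** adj A" for t
  proof -
    \<comment> \<open>Since \<open>Xh ** adj A = A ** H ** adj A\<close>, the right-hand exponential
      is \<open>A ** E t ** adj A\<close>; the \<open>adj A\<close> at the end of
      \<open>\<beta>0\<close> cancels its first factor.\<close>
    have "A ** E t = mat_exp (- (t / 4) *\<^sub>R (Xh ** adj A)) ** A"
      unfolding E_def by (rule mat_exp_intertwine) (simp add: XhH matrix_ring_simps AA)
    then have F: "A ** (E t ** adj A) = mat_exp (- (t / 4) *\<^sub>R (Xh ** adj A))"
      by (simp add: AA matrix_mul_assoc) (simp add: AA flip: matrix_mul_assoc)
    have "\<beta> t = E t ** \<beta>0 ** (A ** (E t ** adj A))"
      unfolding F by (simp only: \<beta>_def E_def H_def)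
    then show ?thesis by (simp add: \<beta>0 S_def AA flip: matrix_mul_assoc)
  qed
  have \<alpha>: "\<alpha> t = A ** C t" for t
    using cayley_adj_eq(2)[OF A(1) S_inv] by (simp add: \<alpha>_def \<beta> C_def)
  show "\<beta> t \<in> cayley_dom (adj A)" for t
    using cayley_adj_eq(1)[OF A(1) S_inv] by (simp add: \<beta>)
  have "S 0 = S0" by (simp add: S_def E_def)
  then show start: "\<alpha> 0 = \<alpha>0"
    by (simp add: \<alpha> C_def S0_def cayley_mat_1_involution[OF U_inv]) (simp add: U_def AA)

  \<comment> \<open>In the chart the condition \<open>\<sigma> Y = adj Y\<close> on \<open>A ** Y\<close> becomes invariance of \<open>Y\<close> under this
    anti-automorphism, which passes through Cayley transforms and exponentials.\<close>
  define \<theta> where "\<theta> Y = adj A ** adj (\<sigma> Y) ** A" for Y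
  have \<theta>_lin: "linear \<theta>"
    by (rule linearI) (simp_all add: \<theta>_def hom_simps matrix_ring_simps)
  have \<theta>_1: "\<theta> (mat 1) = mat 1" by (simp add: \<theta>_def one AA)
  have \<theta>_mult: "\<theta> (Y ** Z) = \<theta> Z ** \<theta> Y" for Y Z
    by (simp add: \<theta>_def hom_simps matrix_ring_simps AA)
  note \<theta>_cayley = cayley_mat_1_antihom[OF \<theta>_lin \<theta>_1 \<theta>_mult]
  note \<theta>_exp = mat_exp_antihom[OF \<theta>_lin \<theta>_1 \<theta>_mult]
  have "\<theta> U = U" by (simp add: \<theta>_def U_def hom_simps A(2) \<alpha>0N(2) matrix_ring_simps AA)
  then have \<theta>_S0: "\<theta> S0 = S0" by (simp add: S0_def \<theta>_cayley[OF U_inv])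
  have "\<theta> H = H"
    by (simp add: \<theta>_def H_def hom_simps A(2) Xh(1) matrix_ring_simps AA)
  then have "\<theta> (E t) = E t" for t by (simp add: E_def \<theta>_exp linear_cmul[OF \<theta>_lin] del: scaleR_minus_left)
  then have "\<theta> (S t) = S t" for t by (simp add: S_def \<theta>_mult \<theta>_S0 matrix_mul_assoc)
  then have \<theta>_C: "\<theta> (C t) = C t" for t by (simp add: C_def \<theta>_cayley[OF S_inv])
  have \<theta>D: "\<sigma> Y = A ** adj Y ** adj A" if "\<theta> Y = Y" for Y
  proof -
    have "A ** adj (\<theta> Y) ** adj A = \<sigma> Y" by (simp add: \<theta>_def matrix_ring_simps AA)
    then show ?thesis by (simp add: that)
  qed
  show "\<beta>0 \<in> cartan_tangent \<sigma> (adj A)"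
    by (simp add: cartan_tangent_def \<beta>0 hom_simps A(2) \<theta>D[OF \<theta>_S0] matrix_ring_simps AA S0_skew)

  have E_der: "(E has_vector_derivative - (1 / 4) *\<^sub>R (H ** E t)) (at t)" for t
  proof -
    have "((\<lambda>t. - (t / 4)) has_vector_derivative - (1 / 4)) (at t)"
      by (auto intro!: derivative_eq_intros)
    from vector_diff_chain_at[OF this has_vector_derivative_mat_exp[of H]]
    show ?thesis by (simp add: E_def[abs_def] o_def)
  qed
  have HE: "E t ** H = H ** E t" for t
    unfolding E_def by (rule mat_exp_intertwine[symmetric]) (simp add: matrix_ring_simps)
  have HE': "E t ** (H ** Y) = H ** (E t ** Y)" for t Y
    by (simp add: HE matrix_mul_assoc)
  have S_der: "(S has_vector_derivative - (1 / 4) *\<^sub>R (H ** S t + S t ** H)) (at t)" for t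
  proof -
    have "(S has_vector_derivative (E t ** S0) ** (- (1 / 4) *\<^sub>R (H ** E t))
        + (E t ** 0 + (- (1 / 4) *\<^sub>R (H ** E t)) ** S0) ** E t) (at t)"
      unfolding S_def[abs_def]
      by (intro mm.has_vector_derivative E_der has_vector_derivative_const)
    then show ?thesis
      by (simp add: S_def matrix_ring_simps HE scaleR_add_right add.commute)
  qed
  define R where "R t = matrix_inv (mat 1 + S t)" for t
  \<comment> \<open>These rules eliminate \<open>S t\<close> next to \<open>R t\<close>, so the
    identity below becomes one between words in \<open>R t\<close> and \<open>H\<close>.\<close>
  have RS: "R t ** S t = mat 1 - R t" "S t ** R t = mat 1 - R t" for t
    using matrix_inv_mult[OF S_inv[of t]] by (simp_all add: R_def matrix_ring_simps eq_diff_eq add.commute)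
  have RS': "S t ** (R t ** Y) = Y - R t ** Y" "R t ** (S t ** Y) = Y - R t ** Y" for t Y
    using RS[of t] by (simp_all add: matrix_mul_assoc mm.diff_left)
  have C_R: "C t = 2 *\<^sub>R R t - mat 1" for t
    by (simp add: C_def R_def cayley_mat_1[OF S_inv])
  have \<alpha>_der: "(\<alpha> has_vector_derivative A ** - (2 *\<^sub>R (R t ** (- (1 / 4) *\<^sub>R (H ** S t + S t ** H)) ** R t))) (at t)" for t
    unfolding \<alpha>[abs_def] C_def R_def
    by (intro bounded_linear.has_vector_derivative[OF mm.bounded_linear_right]
        has_vector_derivative_cayley_skew S_der skew)
  have eq: "4 *\<^sub>R (A ** - (2 *\<^sub>R (R t ** (- (1 / 4) *\<^sub>R (H ** S t + S t ** H)) ** R t))) =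
      Xh - \<alpha> t ** \<sigma> Xh ** \<alpha> t" for t
  proof -
    have four: "4 *\<^sub>R Y = 2 *\<^sub>R Y + 2 *\<^sub>R Y" for Y :: "'k^'n^'n"
      by (simp flip: scaleR_add_left)
    have "\<sigma> Xh = H ** adj A" unfolding Xh(1) by (simp add: XhH adj_mult H_adj)
    then have "Xh - \<alpha> t ** \<sigma> Xh ** \<alpha> t = A ** (H - C t ** H ** C t)"
      by (simp add: XhH \<alpha> matrix_ring_simps AA)
    \<comment> \<open>Both sides equal \<open>2 R H + 2 H R - 4 R H R\<close>; the left one through
      \<open>C = 2 R - 1\<close>, the right one through \<open>S R = R S = 1 - R\<close>.\<close>
    also have "H - C t ** H ** C t = 2 *\<^sub>R (R t ** (H ** S t + S t ** H) ** R t)"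
      by (simp add: C_R matrix_ring_simps RS RS' scaleR_diff_right scaleR_add_right four)
    finally show ?thesis by (simp add: matrix_ring_simps)
  qed
  show "solves_gradient_eq \<sigma> Xh UNIV \<alpha>"
    unfolding solves_gradient_eq_def using \<alpha>_der eq by blast

  have "\<alpha> t \<in> orth_grp" for t
    unfolding \<alpha> C_def by (intro orth_grp_mult A cayley_mat_1_orth skew)
  moreover have "\<sigma> (\<alpha> t) = adj (\<alpha> t)" for t
    by (simp add: \<alpha> hom_simps A(2) \<theta>D[OF \<theta>_C] matrix_ring_simps AA)
  moreover have "\<alpha> 0 \<in> cartan_model \<sigma>" by (simp add: start \<alpha>0)
  ultimately show "\<alpha> t \<in> cartan_model \<sigma>" for t
    by (rule curve_in_cartan_model[OF _ _ \<alpha>_der])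
qed

end

text \<open>Calling \<open>\<alpha>\<close> the solution amounts to existence on the whole line
  together with uniqueness on every interval around 0. The clause on \<open>cartan_gradient\<close>
  justifies calling the differential equation a gradient equation.\<close>

theorem theorem4p1:
  fixes \<sigma> :: "'k::rch_algebra^'n^'n \<Rightarrow> 'k^'n^'n"
    and X Xh A \<alpha>0 \<beta>0 :: "'k^'n^'n"
    and \<alpha> \<beta> :: "real \<Rightarrow> 'k^'n^'n"
  assumes "cartan_involution \<sigma>"
    and "X \<noteq> 0"
    and "Xh = adj X + \<sigma> X"
    and "cartan_critical \<sigma> (height X) A"
    and "\<alpha>0 \<in> cayley_dom A \<inter> cartan_model \<sigma>"
    and "\<beta>0 = cayley A \<alpha>0"
    and "\<And>t. \<beta> t = mat_exp (- (t / 4) *\<^sub>R (adj A ** Xh)) ** \<beta>0 ** mat_exp (- (t / 4) *\<^sub>R (Xh ** adj A))"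
    and "\<And>t. \<alpha> t = cayley (adj A) (\<beta> t)"
  shows "(\<forall>B\<in>cartan_model \<sigma>.
           \<exists>V. cartan_gradient \<sigma> (height X) B V \<and> 4 *\<^sub>R V = Xh - B ** \<sigma> Xh ** B) \<and>
         \<beta>0 \<in> cartan_tangent \<sigma> (adj A) \<and>
         (\<forall>t. \<beta> t \<in> cayley_dom (adj A)) \<and>
         (\<forall>t. \<alpha> t \<in> cartan_model \<sigma>) \<and>
         \<alpha> 0 = \<alpha>0 \<and>
         solves_gradient_eq \<sigma> Xh UNIV \<alpha> \<and>
         (\<forall>J \<gamma>. is_interval J \<and> 0 \<in> J \<and> \<gamma> 0 = \<alpha>0 \<and> solves_gradient_eq \<sigma> Xh J \<gamma> \<longrightarrow>
                 (\<forall>t\<in>J. \<gamma> t = \<alpha> t))"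
proof -
  interpret cartan \<sigma> by unfold_locales fact
  note Xh = assms(3)
  have A: "A \<in> orth_grp" "\<sigma> A = adj A"
    using assms(4) cartan_modelD by (auto simp: cartan_critical_def)
  have \<alpha>0: "\<alpha>0 \<in> cartan_model \<sigma>" "invertible (A + \<alpha>0)"
    using assms(5) by (auto simp: cayley_dom_def)
  have \<sigma>Xh: "\<sigma> Xh = adj Xh" by (simp add: Xh hom_simps matrix_ring_simps add.commute)
  have "\<exists>V. cartan_gradient \<sigma> (height X) B V \<and> 4 *\<^sub>R V = Xh - B ** \<sigma> Xh ** B"
    if "B \<in> cartan_model \<sigma>" for B
    using cartan_gradient_height[OF that Xh] by (intro exI conjI) auto
  moreover note sol = explicit_solution[OF A \<alpha>0 \<sigma>Xh cartan_critical_height[OF assms(4) Xh],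
      folded assms(6), folded assms(7), folded assms(8)]
  have "\<gamma> t = \<alpha> t"
    if "is_interval J" "0 \<in> J" "\<gamma> 0 = \<alpha>0" "solves_gradient_eq \<sigma> Xh J \<gamma>" "t \<in> J" for J \<gamma> t
  proof (rule solves_gradient_eq_unique[OF _ that(4,1,2,5)])
    show "solves_gradient_eq \<sigma> Xh J \<alpha>"
      using sol(5) unfolding solves_gradient_eq_def
      by (meson UNIV_I has_vector_derivative_at_within)
  qed (use sol(4) that(3) in simp)
  ultimately show ?thesis using sol by blast
qed

end
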